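(* Let $\gamma>0$ and let $F$ be a distribution function on $\mathbb{R}$ with $F\in\mathcal{S}_\gamma$ and $\hat\varphi_F<1$. Let $\{\xi_n\}_{n\ge1}$ be i.i.d. random variables with distribution function $F$, and let $S_n$, $M_n$, $M$ be defined from $\{\xi_n\}$ as in the context. Let $\sigma\ge1$ be an almost surely finite stopping time such that $S_\sigma\le0$ a.s., and let $\chi=-S_\sigma\ge0$. Then $$\lim_{x\to\infty}\frac{\mathbf{P}(M_\sigma>x)}{\overline{F}(x)}=\left(1-\mathbf{E} e^{-\gamma\chi}\right)\frac{\mathbf{E} e^{\gamma M}}{1-\hat\varphi_F}.$$
   Context: For a distribution function $F$ on $\mathbb{R}$, let $\overline{F}(x)=1-F(x)$, let $\varphi_F(\alpha)=\int_{-\infty}^\infty e^{\alpha x}\,dF(x)\in[0,\infty]$ for $\alpha\ge0$, and let $F^{*2}$ be the convolution of $F$ with itself. For $\gamma\ge0$, $F\in\mathcal{L}_\gamma$ if and only if $\overline{F}(x)>0$ for all $x$ and $\lim_{x\to\infty}\overline{F}(x-k)/\overline{F}(x)=e^{\gamma k}$ for every fixed $k\in\mathbb{R}$. For $F\in\mathcal{L}_\gamma$ write $\hat\varphi_F=\varphi_F(\gamma)$ (possibly infinite). $F\in\mathcal{S}_\gamma$ if and only if $F\in\mathcal{L}_\gamma$, $\hat\varphi_F<\infty$, and $\overline{F^{*2}}(x)\sim 2\hat\varphi_F\overline{F}(x)$ as $x\to\infty$, i.e. the ratio of the two sides tends to $1$. Random walk: $S_0=0$, $S_n=\sum_{i=1}^n\xi_i$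 for $n\ge1$; $M_n=\max_{0\le i\le n}S_i$ for $n\ge0$; $M=\sup_{n\ge0}S_n$ (almost surely finite when $\gamma>0$ and $\hat\varphi_F<1$). Stopping times are with respect to the filtration $\mathcal{F}_n$ generated by $\{S_k\}_{k\le n}$, and $M_\sigma=\max_{0\le i\le\sigma}S_i$. *)

theory Defs
  imports "HOL-Probability.Probability"
begin

definition distribution_function :: "(real \<Rightarrow> real) \<Rightarrow> bool" where
  "distribution_function F \<longleftrightarrow>
     mono F \<and> (\<forall>a. continuous (at_right a) F) \<and> (F \<longlongrightarrow> 0) at_bot \<and> (F \<longlongrightarrow> 1) at_top"

definition tail :: "(real \<Rightarrow> real) \<Rightarrow> real \<Rightarrow> real" where
  "tail F x = 1 - F x"

(* The measure dF is the Lebesgue-Stieltjes measure interval_measure F; the value may be infinite. *)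
definition mgf :: "(real \<Rightarrow> real) \<Rightarrow> real \<Rightarrow> ennreal" where
  "mgf F \<alpha> = (\<integral>\<^sup>+ x. ennreal (exp (\<alpha> * x)) \<partial>interval_measure F)"

definition conv2 :: "(real \<Rightarrow> real) \<Rightarrow> real \<Rightarrow> real" where
  "conv2 F = cdf (convolution (interval_measure F) (interval_measure F))"

definition class_L :: "real \<Rightarrow> (real \<Rightarrow> real) set" where
  "class_L \<gamma> = {F. distribution_function F \<and> (\<forall>x. tail F x > 0) \<and>
     (\<forall>k. ((\<lambda>x. tail F (x - k) / tail F x) \<longlongrightarrow> exp (\<gamma> * k)) at_top)}"

definition class_S :: "real \<Rightarrow> (real \<Rightarrow> real) set" where
  "class_S \<gamma> = {F. F \<in> class_L \<gamma> \<and> mgf F \<gamma> < \<infinity> \<and>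
     ((\<lambda>x. tail (conv2 F) x / (2 * enn2real (mgf F \<gamma>) * tail F x)) \<longlongrightarrow> 1) at_top}"

(* The steps are indexed from 1; the value \<xi> 0 is never used. *)
definition walk :: "(nat \<Rightarrow> 'a \<Rightarrow> real) \<Rightarrow> nat \<Rightarrow> 'a \<Rightarrow> real" where
  "walk \<xi> n \<omega> = (\<Sum>i=1..n. \<xi> i \<omega>)"

definition walk_max :: "(nat \<Rightarrow> 'a \<Rightarrow> real) \<Rightarrow> nat \<Rightarrow> 'a \<Rightarrow> real" where
  "walk_max \<xi> n \<omega> = Max ((\<lambda>i. walk \<xi> i \<omega>) ` {0..n})"

definition walk_sup :: "(nat \<Rightarrow> 'a \<Rightarrow> real) \<Rightarrow> 'a \<Rightarrow> ereal" where
  "walk_sup \<xi> \<omega> = (SUP n. ereal (walk \<xi> n \<omega>))"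

(* Time is indexed by enat so that stopping times may take the value \<infinity>; the \<sigma>-algebra at
   time \<infinity> is generated by the whole walk, and the stopping-time condition there is vacuous. *)
definition walk_filtration :: "'a measure \<Rightarrow> (nat \<Rightarrow> 'a \<Rightarrow> real) \<Rightarrow> enat \<Rightarrow> 'a measure" where
  "walk_filtration P \<xi> t =
     sigma (space P) {walk \<xi> k -` A \<inter> space P | k A. enat k \<le> t \<and> A \<in> sets borel}"

end

(* Let M be the supremum of the walk, G its tail and C = E exp(gamma M) / (1 - phi).  Splitting at
   sigma and using the strong Markov property, P(M_sigma > x) = G(x) - E[1{M_sigma <= x} G(x + chi)],
   so that G ~ C * tail F and dominated convergence give the limit C - C E exp(-gamma chi).

   For G ~ C * tail F, a Kesten type induction over the Lindley recursion
   P(M_{n+1} > x) = P(xi + M_n > x), x >= 0, first shows G <= K * tail F; the class S_gamma controls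
   the event that both summands are large.  The fixed point equation G(x) = P(xi + M > x) then
   turns an asymptotic bound D on |G / tail F - C| into phi * D, and phi < 1. *)
theory Submission
  imports Defs
begin

subsection \<open>Tails of convolutions\<close>

text \<open>Dominated convergence cannot be applied to P(xi + M > x) / tail F x as a whole: for
  steps y close to x the ratio tail F (x - y) / tail F x is unbounded as x grows. Hence every
  convolution is cut at a level A. A piece in which one summand is at most A converges by
  domination. For two copies of F the two such pieces make up, as A grows, the whole limit 2 * phi,
  so the self-convolution condition says exactly that the piece with both summands large is
  negligible. The same piece for xi and M can be compared with it only once G <= K * tail F is
  known, and that bound has to come from the finite maxima, because for M itself there is no
  constant to start an induction from. The constant C solves C = phi * C + E exp(gamma M), the
  balance of the two pieces with one bounded summand. Existence of the limit of G / tail F is not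
  known beforehand, so the equation is used as a contraction on eventual error bounds. Finiteness of
  M and of its exponential moment come from comparing exp(gamma M) with the sum of all exp(gamma
  S_n), a geometric series in expectation.\<close>

definition upper_tail :: "real measure \<Rightarrow> real \<Rightarrow> real" where
  "upper_tail M x = measure M {x<..}"

lemma measure_pair_measure_fst:
  assumes "prob_space M" "prob_space N" "A \<in> sets (M \<Otimes>\<^sub>M N)"
  shows "measure (M \<Otimes>\<^sub>M N) A = (\<integral>x. measure N (Pair x -` A) \<partial>M)"
proof -
  interpret M: prob_space M by fact
  interpret N: prob_space N by fact
  interpret pair_prob_space M N ..
  have [measurable]: "(\<lambda>x. measure N (Pair x -` A)) \<in> borel_measurable M"
    unfolding measure_def using N.measurable_emeasure_Pair[OF assms(3)] by measurable
  have "emeasure (M \<Otimes>\<^sub>M N) A = (\<integral>\<^sup>+x. ennreal (measure N (Pair x -` A)) \<partial>M)"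
    by (simp add: N.emeasure_pair_measure_alt[OF assms(3)] N.emeasure_eq_measure)
  then show ?thesis
    by (subst integral_eq_nn_integral) (auto simp: measure_def[of "M \<Otimes>\<^sub>M N"])
qed

lemma measure_pair_measure_snd:
  assumes "prob_space M" "prob_space N" "A \<in> sets (M \<Otimes>\<^sub>M N)"
  shows "measure (M \<Otimes>\<^sub>M N) A = (\<integral>y. measure M ((\<lambda>x. (x, y)) -` A) \<partial>N)"
proof -
  interpret M: prob_space M by fact
  interpret N: prob_space N by fact
  interpret pair_prob_space M N ..
  have [measurable]: "(\<lambda>y. measure M ((\<lambda>x. (x, y)) -` A)) \<in> borel_measurable N"
    unfolding measure_def using measurable_emeasure_Pair2[OF assms(3)] by measurable
  have "emeasure (M \<Otimes>\<^sub>M N) A = (\<integral>\<^sup>+y. ennreal (measure M ((\<lambda>x. (x, y)) -` A)) \<partial>N)"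
    by (simp add: emeasure_pair_measure_alt2[OF assms(3)] M.emeasure_eq_measure)
  then show ?thesis
    by (subst integral_eq_nn_integral) (auto simp: measure_def[of "M \<Otimes>\<^sub>M N"])
qed

context real_distribution
begin

lemma upper_tail_eq: "upper_tail M x = 1 - cdf M x"
proof -
  have "{x<..} = space M - {..x}" by auto
  moreover have "{..x} \<in> events" by simp
  ultimately show ?thesis unfolding upper_tail_def cdf_def by (metis prob_compl)
qed

lemma upper_tail_nonneg: "0 \<le> upper_tail M x"
  by (simp add: upper_tail_def)

lemma upper_tail_le_1: "upper_tail M x \<le> 1"
  by (simp add: upper_tail_def)

lemma upper_tail_antimono: "x \<le> y \<Longrightarrow> upper_tail M y \<le> upper_tail M x"
  unfolding upper_tail_def by (intro finite_measure_mono) auto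

lemma borel_measurable_upper_tail [measurable]: "upper_tail M \<in> borel_measurable borel"
proof -
  have "mono (\<lambda>x. - upper_tail M x)"
    by (auto simp: mono_def upper_tail_antimono)
  then have "(\<lambda>x. - upper_tail M x) \<in> borel_measurable borel"
    by (rule borel_measurable_mono)
  from borel_measurable_uminus[OF this] show ?thesis by simp
qed

end

lemma Collect_in_sets_pair:
  fixes M N :: "real measure"
  assumes "sets M = sets borel" "sets N = sets borel" "Measurable.pred (borel \<Otimes>\<^sub>M borel) Q"
  shows "{p. Q p} \<in> sets (M \<Otimes>\<^sub>M N)"
  using assms(3) sets_pair_measure_cong[OF assms(1,2)]
  by (simp add: pred_def space_pair_measure)

text \<open>Which of the two summands exceeds \<open>A\<close> determines the three terms; both cannot be at most
  \<open>A\<close> when the sum exceeds \<open>x \<ge> 2 A\<close>.\<close>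

lemma integral_upper_tail_split:
  assumes "real_distribution M" "real_distribution N" and x: "2 * A \<le> x"
  shows "(\<integral>y. upper_tail N (x - y) \<partial>M) =
    (\<integral>y. indicator {..A} y * upper_tail N (x - y) \<partial>M) +
    (\<integral>z. indicator {..A} z * upper_tail M (x - z) \<partial>N) +
    (\<integral>y. indicator {A<..} y * upper_tail N (max A (x - y)) \<partial>M)"
proof -
  interpret M: real_distribution M by fact
  interpret N: real_distribution N by fact
  interpret pair_prob_space M N ..
  let ?U = "{p. fst p + snd p > x} :: (real \<times> real) set"
  let ?A1 = "{p. fst p \<le> A \<and> fst p + snd p > x} :: (real \<times> real) set"
  let ?A2 = "{p. snd p \<le> A \<and> fst p + snd p > x} :: (real \<times> real) set"
  let ?A3 = "{p. fst p > A \<and> snd p > A \<and> fst p + snd p > x} :: (real \<times> real) set"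
  have S: "sets (M \<Otimes>\<^sub>M N) = sets (borel \<Otimes>\<^sub>M borel)" "space (M \<Otimes>\<^sub>M N) = UNIV"
    by (auto simp: space_pair_measure intro!: sets_pair_measure_cong)
  have meas: "?U \<in> sets (M \<Otimes>\<^sub>M N)" "?A1 \<in> sets (M \<Otimes>\<^sub>M N)" "?A2 \<in> sets (M \<Otimes>\<^sub>M N)" "?A3 \<in> sets (M \<Otimes>\<^sub>M N)"
    by (rule Collect_in_sets_pair, simp, simp, measurable)+
  have "?U = ?A1 \<union> ?A2 \<union> ?A3" by auto
  moreover have "?A1 \<inter> ?A2 = {}" "(?A1 \<union> ?A2) \<inter> ?A3 = {}"
    using x by auto
  ultimately have "measure (M \<Otimes>\<^sub>M N) ?U = measure (M \<Otimes>\<^sub>M N) ?A1 + measure (M \<Otimes>\<^sub>M N) ?A2 + measure (M \<Otimes>\<^sub>M N) ?A3"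
    using meas by (simp add: P.finite_measure_Union sets.Un)
  moreover have "measure (M \<Otimes>\<^sub>M N) ?U = (\<integral>y. upper_tail N (x - y) \<partial>M)"
    unfolding measure_pair_measure_fst[OF M.prob_space_axioms N.prob_space_axioms meas(1)] upper_tail_def
    by (intro Bochner_Integration.integral_cong arg_cong[where f="measure N"]) auto
  moreover have "measure (M \<Otimes>\<^sub>M N) ?A1 = (\<integral>y. indicator {..A} y * upper_tail N (x - y) \<partial>M)"
    unfolding measure_pair_measure_fst[OF M.prob_space_axioms N.prob_space_axioms meas(2)] upper_tail_def
  proof (intro Bochner_Integration.integral_cong refl)
    fix y
    have "Pair y -` ?A1 = (if y \<le> A then {x - y<..} else {})" by auto
    then show "measure N (Pair y -` ?A1) = indicator {..A} y * measure N {x - y<..}" by simp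
  qed
  \<comment> \<open>Here the second summand is the bounded one, so it becomes the outer variable;
    this is what puts the tail of \<open>M\<close> under an integral over \<open>N\<close>.\<close>
  moreover have "measure (M \<Otimes>\<^sub>M N) ?A2 = (\<integral>z. indicator {..A} z * upper_tail M (x - z) \<partial>N)"
    unfolding measure_pair_measure_snd[OF M.prob_space_axioms N.prob_space_axioms meas(3)] upper_tail_def
  proof (intro Bochner_Integration.integral_cong refl)
    fix y
    have "(\<lambda>x. (x, y)) -` ?A2 = (if y \<le> A then {x - y<..} else {})" by auto
    then show "measure M ((\<lambda>x. (x, y)) -` ?A2) = indicator {..A} y * measure M {x - y<..}" by simp
  qed
  \<comment> \<open>For fixed \<open>y > A\<close> the second summand must exceed both
    \<open>A\<close> and \<open>x - y\<close>; the two conditions merge into the single threshold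
    \<open>max A (x - y)\<close>.\<close>
  moreover have "measure (M \<Otimes>\<^sub>M N) ?A3 = (\<integral>y. indicator {A<..} y * upper_tail N (max A (x - y)) \<partial>M)"
    unfolding measure_pair_measure_fst[OF M.prob_space_axioms N.prob_space_axioms meas(4)] upper_tail_def
  proof (intro Bochner_Integration.integral_cong refl)
    fix y
    have "Pair y -` ?A3 = (if y > A then {max A (x - y)<..} else {})" by auto
    then show "measure N (Pair y -` ?A3) = indicator {A<..} y * measure N {max A (x - y)<..}" by simp
  qed
  ultimately show ?thesis by simp
qed

lemma upper_tail_convolution:
  assumes "real_distribution M" "real_distribution N"
  shows "1 - cdf (convolution M N) x = (\<integral>y. upper_tail N (x - y) \<partial>M)"
proof -
  interpret M: real_distribution M by fact
  interpret N: real_distribution N by fact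
  interpret pair_prob_space M N ..
  have m [measurable]: "(\<lambda>(x, y). x + y) \<in> borel_measurable (M \<Otimes>\<^sub>M N)" by measurable
  interpret C: real_distribution "convolution M N"
    unfolding convolution_def by (intro real_distribution_distr) measurable
  have S: "sets (M \<Otimes>\<^sub>M N) = sets (borel \<Otimes>\<^sub>M borel)" "space (M \<Otimes>\<^sub>M N) = UNIV"
    by (auto simp: space_pair_measure intro!: sets_pair_measure_cong)
  have meas: "{p. fst p + snd p > x} \<in> sets (M \<Otimes>\<^sub>M N)"
    by (rule Collect_in_sets_pair, simp, simp, measurable)
  have "1 - cdf (convolution M N) x = measure (convolution M N) {x<..}"
    using C.upper_tail_eq[of x] by (simp add: upper_tail_def)
  also have "\<dots> = measure (M \<Otimes>\<^sub>M N) {p. fst p + snd p > x}"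
    unfolding convolution_def by (subst measure_distr[OF m]) (auto simp: S(2) split_beta' intro!: arg_cong[where f="measure _"])
  also have "\<dots> = (\<integral>y. upper_tail N (x - y) \<partial>M)"
    unfolding measure_pair_measure_fst[OF M.prob_space_axioms N.prob_space_axioms meas] upper_tail_def
    by (intro Bochner_Integration.integral_cong arg_cong[where f="measure N"]) auto
  finally show ?thesis .
qed

subsection \<open>Convolution equivalent distributions\<close>

text \<open>The class S_gamma restated for a measure. The self-convolution condition appears as an
  integral of shifted tails, the form that \<open>integral_upper_tail_split\<close> takes
  apart.\<close>

locale convolution_equivalent = real_distribution M for M :: "real measure" +
  fixes \<gamma> :: real
  assumes \<gamma>_pos: "0 < \<gamma>"
    and upper_tail_pos: "0 < upper_tail M x"
    and upper_tail_shift: "((\<lambda>x. upper_tail M (x - k) / upper_tail M x) \<longlongrightarrow> exp (\<gamma> * k)) at_top"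
    and integrable_exp: "integrable M (\<lambda>x. exp (\<gamma> * x))"
    and upper_tail_self_convolution:
      "((\<lambda>x. (\<integral>y. upper_tail M (x - y) \<partial>M) / upper_tail M x) \<longlongrightarrow> 2 * (\<integral>x. exp (\<gamma> * x) \<partial>M)) at_top"
begin

abbreviation "T \<equiv> upper_tail M"
abbreviation "phi \<equiv> \<integral>x. exp (\<gamma> * x) \<partial>M"

text \<open>For \<open>z \<le> A\<close> the ratio \<open>T (x - z) / T x\<close> is at most
  \<open>T (x - A) / T x\<close>, which converges and is therefore eventually bounded by a constant;
  this is the domination. \<open>N\<close> is arbitrary because the lemma serves both the step law
  and the law of the supremum.\<close>

lemma truncated_ratio_tendsto:
  assumes "real_distribution N"
  shows "((\<lambda>x. (\<integral>z. indicator {..A} z * T (x - z) \<partial>N) / T x) \<longlongrightarrow>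
    (\<integral>z. indicator {..A} z * exp (\<gamma> * z) \<partial>N)) at_top"
proof -
  interpret N: real_distribution N by fact
  have "((\<lambda>x. \<integral>z. indicator {..A} z * (T (x - z) / T x) \<partial>N) \<longlongrightarrow>
    (\<integral>z. indicator {..A} z * exp (\<gamma> * z) \<partial>N)) at_top"
  proof (rule integral_dominated_convergence_at_top[where w="\<lambda>_. exp (\<gamma> * A) + 1"])
    show "AE z in N. ((\<lambda>x. indicator {..A} z * (T (x - z) / T x)) \<longlongrightarrow>
        indicator {..A} z * exp (\<gamma> * z)) at_top"
      by (intro AE_I2 tendsto_intros upper_tail_shift)
    have "\<forall>\<^sub>F x in at_top. T (x - A) / T x < exp (\<gamma> * A) + 1"
      using order_tendstoD(2)[OF upper_tail_shift, of A "exp (\<gamma> * A) + 1"] by simp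
    then show "\<forall>\<^sub>F x in at_top. AE z in N. norm (indicator {..A} z * (T (x - z) / T x)) \<le> exp (\<gamma> * A) + 1"
    proof eventually_elim
      case (elim x)
      have "indicator {..A} z * (T (x - z) / T x) \<le> exp (\<gamma> * A) + 1" for z
      proof (cases "z \<le> A")
        case True
        then have "T (x - z) / T x \<le> T (x - A) / T x"
          using upper_tail_pos[of x] by (intro divide_right_mono upper_tail_antimono) auto
        with True elim show ?thesis by simp
      qed simp
      then show ?case
        using upper_tail_pos[of x] by (intro AE_I2) (simp add: upper_tail_nonneg)
    qed
  qed (auto simp: borel_measurable_upper_tail)
  then show ?thesis
    by simp
qed

lemma truncated_exp_tendsto:
  assumes "real_distribution N" "integrable N (\<lambda>x. exp (\<gamma> * x))"
  shows "((\<lambda>A. \<integral>z. indicator {..A} z * exp (\<gamma> * z) \<partial>N) \<longlongrightarrow> (\<integral>z. exp (\<gamma> * z) \<partial>N)) at_top"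
proof -
  interpret N: real_distribution N by fact
  show ?thesis
  proof (rule integral_dominated_convergence_at_top[where w="\<lambda>z. exp (\<gamma> * z)"])
    show "AE z in N. ((\<lambda>A. indicator {..A} z * exp (\<gamma> * z)) \<longlongrightarrow> exp (\<gamma> * z)) at_top"
    proof (intro AE_I2 tendsto_eventually)
      fix z :: real
      show "\<forall>\<^sub>F A in at_top. indicator {..A} z * exp (\<gamma> * z) = exp (\<gamma> * z)"
        using eventually_ge_at_top[of z] by eventually_elim simp
    qed
    show "\<forall>\<^sub>F A in at_top. AE z in N. norm (indicator {..A} z * exp (\<gamma> * z)) \<le> exp (\<gamma> * z)"
      by (intro always_eventually allI AE_I2) (simp add: indicator_def)
  qed (use assms(2) in auto)
qed

text \<open>P(X > A, Y > A, X + Y > x) for independent X and Y with law \<open>M\<close>.\<close>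

definition both_large :: "real \<Rightarrow> real \<Rightarrow> real" where
  "both_large A x = (\<integral>y. indicator {A<..} y * T (max A (x - y)) \<partial>M)"

text \<open>The full convolution contributes \<open>2 * phi\<close>, and by symmetry the two pieces
  with a bounded summand remove the same truncated moment. The limit tends to 0 as A grows, which is
  how it is used later.\<close>

lemma both_large_tendsto:
  "((\<lambda>x. both_large A x / T x) \<longlongrightarrow> 2 * phi - 2 * (\<integral>z. indicator {..A} z * exp (\<gamma> * z) \<partial>M)) at_top"
proof (rule Lim_transform_eventually)
  let ?J = "\<lambda>x. \<integral>z. indicator {..A} z * T (x - z) \<partial>M"
  show "((\<lambda>x. (\<integral>y. T (x - y) \<partial>M) / T x - 2 * (?J x / T x)) \<longlongrightarrow>
      2 * phi - 2 * (\<integral>z. indicator {..A} z * exp (\<gamma> * z) \<partial>M)) at_top"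
    by (intro tendsto_intros upper_tail_self_convolution truncated_ratio_tendsto real_distribution_axioms)
  show "\<forall>\<^sub>F x in at_top. (\<integral>y. T (x - y) \<partial>M) / T x - 2 * (?J x / T x) = both_large A x / T x"
    using eventually_ge_at_top[of "2 * A"]
  proof eventually_elim
    case (elim x)
    show ?case
      using integral_upper_tail_split[OF real_distribution_axioms real_distribution_axioms elim]
      by (simp add: both_large_def add_divide_distrib)
  qed
qed

lemma integrable_bounded:
  assumes "f \<in> borel_measurable borel" "\<And>x. 0 \<le> f x" "\<And>x. f x \<le> (c :: real)"
  shows "integrable M f"
  using assms by (intro integrable_const_bound[where B=c]) auto

text \<open>Kesten's bound. Since \<open>phi < 1\<close>, one step of the recursion contracts the constant by a factor
  \<open>r < 1\<close>, up to the error \<open>B\<close> coming from a single large jump.\<close>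

lemma kesten_bound:
  assumes "phi < 1"
    and [measurable]: "\<And>n. h n \<in> borel_measurable borel"
    and h01: "\<And>n x. 0 \<le> h n x" "\<And>n x. h n x \<le> 1"
    and h0: "\<And>x. 0 \<le> x \<Longrightarrow> h 0 x = 0"
    and hSuc: "\<And>n x. 0 \<le> x \<Longrightarrow> h (Suc n) x = (\<integral>y. h n (x - y) \<partial>M)"
  obtains K where "\<And>n x. h n x \<le> K * T x" "0 \<le> K"
proof -
  note [measurable] = borel_measurable_upper_tail
  define r where "r = (1 + phi) / 2"
  have r: "phi < r" "r < 1" using assms(1) by (auto simp: r_def)
  let ?a = "\<lambda>A. \<integral>z. indicator {..A} z * exp (\<gamma> * z) \<partial>M"
  let ?J = "\<lambda>A x. \<integral>z. indicator {..A} z * T (x - z) \<partial>M"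
  \<comment> \<open>\<open>2 * phi - ?a A\<close> is the limit, relative to \<open>T x\<close>, of
    the two pieces that will carry the factor \<open>K\<close>, namely \<open>?a A\<close> from a
    bounded step and \<open>2 * phi - 2 * ?a A\<close> from two large summands. It tends to
    \<open>phi < r\<close>, which fixes \<open>A\<close>.\<close>
  have "((\<lambda>A. 2 * phi - ?a A) \<longlongrightarrow> 2 * phi - phi) at_top"
    by (intro tendsto_intros truncated_exp_tendsto real_distribution_axioms integrable_exp)
  then have "\<forall>\<^sub>F A in at_top. 2 * phi - ?a A < r"
    using r by (intro order_tendstoD(2)) auto
  then obtain A where A: "2 * phi - ?a A < r"
    by (auto dest: eventually_happens)
  define B where "B = exp (\<gamma> * A) + 1"
  have "((\<lambda>x. ?J A x / T x + both_large A x / T x) \<longlongrightarrow> ?a A + (2 * phi - 2 * ?a A)) at_top"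
    by (intro tendsto_intros both_large_tendsto truncated_ratio_tendsto real_distribution_axioms)
  then have "\<forall>\<^sub>F x in at_top. ?J A x / T x + both_large A x / T x < r"
    using A by (intro order_tendstoD(2)) auto
  moreover have "\<forall>\<^sub>F x in at_top. T (x - A) / T x < B"
    using order_tendstoD(2)[OF upper_tail_shift, of A B] by (simp add: B_def)
  ultimately have "\<forall>\<^sub>F x in at_top. ?J A x + both_large A x \<le> r * T x \<and> T (x - A) \<le> B * T x"
  proof eventually_elim
    case (elim x)
    then show ?case
      using upper_tail_pos[of x] by (simp add: field_simps)
  qed
  then obtain x1' where x1': "\<And>x. x1' \<le> x \<Longrightarrow> ?J A x + both_large A x \<le> r * T x \<and> T (x - A) \<le> B * T x"
    by (auto simp: eventually_at_top_linorder)
  \<comment> \<open>The recursion for \<open>h\<close> is available only for nonnegative arguments,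
    hence the maximum with 0.\<close>
  define x1 where "x1 = max 0 x1'"
  \<comment> \<open>The first entry gives \<open>B + K * r \<le> K\<close>, which closes the
    induction step above \<open>x1\<close>; the second makes \<open>K * T x \<ge> 1\<close> below
    \<open>x1\<close>, where \<open>h \<le> 1\<close> suffices.\<close>
  define K where "K = max (B / (1 - r)) (1 / T x1)"
  have K0: "0 \<le> K" using upper_tail_pos[of x1] by (simp add: K_def le_max_iff_disj)
  have KB: "B + K * r \<le> K"
  proof -
    have "B / (1 - r) \<le> K" by (simp add: K_def)
    then have "B \<le> K * (1 - r)" using r by (simp add: pos_divide_le_eq)
    then show ?thesis by (simp add: algebra_simps)
  qed
  have small: "1 \<le> K * T x" if "x < x1" for x
  proof -
    have "1 \<le> T x / T x1"
      using upper_tail_pos[of x1] upper_tail_antimono[of x x1] that by simp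
    also have "\<dots> = (1 / T x1) * T x" by simp
    also have "\<dots> \<le> K * T x"
      by (intro mult_right_mono) (auto simp: K_def upper_tail_nonneg)
    finally show ?thesis .
  qed
  have "h n x \<le> K * T x" for n x
  proof (induction n arbitrary: x)
    case 0
    show ?case
    proof (cases "x < x1")
      case True
      then show ?thesis using small[OF True] h01(2)[of 0 x] by linarith
    next
      case False
      then show ?thesis using h0[of x] K0 by (auto simp: x1_def upper_tail_nonneg)
    qed
  next
    case (Suc n)
    show ?case
    proof (cases "x < x1")
      case True
      then show ?thesis using small[OF True] h01(2)[of "Suc n" x] by linarith
    next
      case False
      then have x: "0 \<le> x" "x1' \<le> x" by (auto simp: x1_def)
      \<comment> \<open>For \<open>y > x - A\<close> the threshold in \<open>both_large\<close> is
        \<open>A\<close> and no longer \<open>x - y\<close>, so the induction hypothesis gives too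
        large a bound. There \<open>h \<le> 1\<close> is used instead: it costs
        \<open>T (x - A) \<le> B * T x\<close>, without a factor \<open>K\<close>.\<close>
      have le: "h n (x - y) \<le> K * (indicator {..A} y * T (x - y)) +
          K * (indicator {A<..} y * T (max A (x - y))) + indicator {x - A<..} y" for y
      proof -
        consider "y \<le> A" | "A < y" "y \<le> x - A" | "A < y" "x - A < y" by linarith
        then show ?thesis
        proof cases
          case 1
          then show ?thesis using Suc[of "x - y"] by (simp add: indicator_def)
        next
          case 2
          then have "max A (x - y) = x - y" by simp
          then show ?thesis using Suc[of "x - y"] 2 by simp
        next
          case 3
          then show ?thesis using h01(2)[of n "x - y"] K0
            by (simp add: upper_tail_nonneg add_increasing)
        qed
      qed
      have i: "integrable M (\<lambda>y. indicator {..A} y * T (x - y))"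
        "integrable M (\<lambda>y. indicator {A<..} y * T (max A (x - y)))"
        "integrable M (\<lambda>y. h n (x - y))" "integrable M (\<lambda>y. indicator {x - A<..} y :: real)"
        by (rule integrable_bounded[where c=1];
            auto simp: indicator_def upper_tail_nonneg upper_tail_le_1 h01)+
      have "h (Suc n) x = (\<integral>y. h n (x - y) \<partial>M)" by (rule hSuc[OF x(1)])
      also have "\<dots> \<le> (\<integral>y. K * (indicator {..A} y * T (x - y)) +
          K * (indicator {A<..} y * T (max A (x - y))) + indicator {x - A<..} y \<partial>M)"
        by (intro integral_mono Bochner_Integration.integrable_add integrable_mult_right i le)
      also have "\<dots> = K * ?J A x + K * both_large A x + T (x - A)"
        using i by (simp add: both_large_def upper_tail_def)
      also have "\<dots> = K * (?J A x + both_large A x) + T (x - A)" by (simp add: algebra_simps)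
      also have "\<dots> \<le> K * (r * T x) + B * T x"
        using x1'[OF x(2)] K0 by (intro add_mono mult_left_mono) auto
      also have "\<dots> = (B + K * r) * T x" by (simp add: algebra_simps)
      also have "\<dots> \<le> K * T x"
        by (intro mult_right_mono KB upper_tail_nonneg)
      finally show ?thesis .
    qed
  qed
  with K0 that show ?thesis by blast
qed

text \<open>In the split fixed point equation a step \<open>y \<le> A\<close> evaluates the tail of
  \<open>N\<close> at \<open>x - y \<ge> x - A\<close>, still in the range of the old bound
  \<open>D\<close>, so this piece carries an error of about \<open>phi * D\<close>. The piece with a
  bounded \<open>N\<close>-summand converges by itself, and the piece with both large is at most
  \<open>K\<close> times \<open>both_large\<close>. Taking \<open>A\<close> large pushes everything
  beyond \<open>phi * D\<close> under \<open>\<epsilon>\<close>.\<close>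

lemma fixed_point_tail_contraction:
  assumes "real_distribution N"
    and K: "\<And>x. upper_tail N x \<le> K * T x"
    and fp: "\<And>x. 0 \<le> x \<Longrightarrow> upper_tail N x = (\<integral>y. upper_tail N (x - y) \<partial>M)"
    and int: "integrable N (\<lambda>x. exp (\<gamma> * x))"
    and C: "C = phi * C + (\<integral>x. exp (\<gamma> * x) \<partial>N)" "0 \<le> C"
    and D: "\<forall>\<^sub>F x in at_top. \<bar>upper_tail N x / T x - C\<bar> \<le> D"
    and \<epsilon>: "0 < \<epsilon>"
  shows "\<forall>\<^sub>F x in at_top. \<bar>upper_tail N x / T x - C\<bar> \<le> phi * D + \<epsilon>"
proof -
  interpret N: real_distribution N by fact
  note [measurable] = borel_measurable_upper_tail N.borel_measurable_upper_tail
  let ?G = "upper_tail N"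
  let ?m = "\<integral>z. exp (\<gamma> * z) \<partial>N"
  let ?a = "\<lambda>A. \<integral>z. indicator {..A} z * exp (\<gamma> * z) \<partial>M"
  let ?b = "\<lambda>A. \<integral>z. indicator {..A} z * exp (\<gamma> * z) \<partial>N"
  let ?J = "\<lambda>A x. \<integral>z. indicator {..A} z * T (x - z) \<partial>M"
  let ?J' = "\<lambda>A x. \<integral>z. indicator {..A} z * T (x - z) \<partial>N"
  \<comment> \<open>The same four-term error bound is passed to the limit twice: here
    \<open>A\<close> grows, after x has already gone to infinity; below, for the fixed
    \<open>A\<close>, x grows.\<close>
  have "((\<lambda>A. D * ?a A + C * \<bar>?a A - phi\<bar> + \<bar>?b A - ?m\<bar> + K * (2 * phi - 2 * ?a A)) \<longlongrightarrow>
      D * phi + C * \<bar>phi - phi\<bar> + \<bar>?m - ?m\<bar> + K * (2 * phi - 2 * phi)) at_top"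
    by (intro tendsto_intros truncated_exp_tendsto real_distribution_axioms integrable_exp assms(1) int)
  then have "\<forall>\<^sub>F A in at_top. D * ?a A + C * \<bar>?a A - phi\<bar> + \<bar>?b A - ?m\<bar> + K * (2 * phi - 2 * ?a A) < phi * D + \<epsilon>"
    using \<epsilon> by (intro order_tendstoD(2)) (auto simp: mult.commute)
  then obtain A where A: "D * ?a A + C * \<bar>?a A - phi\<bar> + \<bar>?b A - ?m\<bar> + K * (2 * phi - 2 * ?a A) < phi * D + \<epsilon>"
    by (auto dest: eventually_happens)
  let ?U = "\<lambda>x. D * (?J A x / T x) + C * \<bar>?J A x / T x - phi\<bar> + \<bar>?J' A x / T x - ?m\<bar> + K * (both_large A x / T x)"
  have "(?U \<longlongrightarrow> D * ?a A + C * \<bar>?a A - phi\<bar> + \<bar>?b A - ?m\<bar> + K * (2 * phi - 2 * ?a A)) at_top"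
    by (intro tendsto_intros both_large_tendsto truncated_ratio_tendsto real_distribution_axioms assms(1))
  then have U: "\<forall>\<^sub>F x in at_top. ?U x < phi * D + \<epsilon>"
    using A by (rule order_tendstoD(2))
  obtain x0 where x0: "\<And>x. x0 \<le> x \<Longrightarrow> \<bar>?G x / T x - C\<bar> \<le> D"
    using D by (auto simp: eventually_at_top_linorder)
  show ?thesis
    \<comment> \<open>The thresholds: \<open>x0 + A\<close> keeps \<open>x - y \<ge> x0\<close> for
      all \<open>y \<le> A\<close>, 0 is for the fixed point equation, \<open>2 * A\<close> for the
      splitting.\<close>
    using U eventually_ge_at_top[of "x0 + A"] eventually_ge_at_top[of 0] eventually_ge_at_top[of "2 * A"]
  proof eventually_elim
    case (elim x)
    have Tx: "0 < T x" by (rule upper_tail_pos)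
    define I where "I = (\<integral>y. indicator {..A} y * ?G (x - y) \<partial>M)"
    define R where "R = (\<integral>y. indicator {A<..} y * ?G (max A (x - y)) \<partial>M)"
    have i: "integrable M (\<lambda>y. indicator {..A} y * T (x - y))"
        "integrable M (\<lambda>y. indicator {A<..} y * T (max A (x - y)))"
        "integrable M (\<lambda>y. indicator {..A} y * ?G (x - y))"
        "integrable M (\<lambda>y. indicator {A<..} y * ?G (max A (x - y)))"
      by (rule integrable_bounded[where c=1]; auto simp: indicator_def upper_tail_nonneg
          upper_tail_le_1 N.upper_tail_nonneg N.upper_tail_le_1)+
    have split: "?G x = I + ?J' A x + R"
      using fp[OF elim(3)] integral_upper_tail_split[OF real_distribution_axioms assms(1) elim(4)]
      by (simp add: I_def R_def)
    have "R \<le> (\<integral>y. K * (indicator {A<..} y * T (max A (x - y))) \<partial>M)"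
      unfolding R_def by (intro integral_mono i integrable_mult_right) (simp add: indicator_def K)
    then have R: "0 \<le> R / T x" "R / T x \<le> K * (both_large A x / T x)"
      using Tx by (auto simp: both_large_def R_def divide_right_mono N.upper_tail_nonneg intro!: divide_nonneg_pos)
    have "\<bar>I - C * ?J A x\<bar> = \<bar>\<integral>y. indicator {..A} y * ?G (x - y) - C * (indicator {..A} y * T (x - y)) \<partial>M\<bar>"
      using i by (simp add: I_def)
    also have "\<dots> \<le> (\<integral>y. \<bar>indicator {..A} y * ?G (x - y) - C * (indicator {..A} y * T (x - y))\<bar> \<partial>M)"
      by (rule integral_abs_bound)
    also have "\<dots> \<le> (\<integral>y. D * (indicator {..A} y * T (x - y)) \<partial>M)"
    proof (intro integral_mono i integrable_mult_right integrable_abs Bochner_Integration.integrable_diff)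
      fix y
      have "\<bar>?G (x - y) - C * T (x - y)\<bar> \<le> D * T (x - y)" if "y \<le> A"
      proof -
        have "\<bar>?G (x - y) / T (x - y) - C\<bar> * T (x - y) \<le> D * T (x - y)"
          using x0[of "x - y"] elim(2) that by (intro mult_right_mono upper_tail_nonneg) auto
        moreover have "\<bar>?G (x - y) / T (x - y) - C\<bar> * T (x - y) = \<bar>(?G (x - y) / T (x - y) - C) * T (x - y)\<bar>"
          by (simp add: abs_mult upper_tail_nonneg)
        moreover have "(?G (x - y) / T (x - y) - C) * T (x - y) = ?G (x - y) - C * T (x - y)"
          using upper_tail_pos[of "x - y"] by (simp add: left_diff_distrib)
        ultimately show ?thesis by simp
      qed
      then show "\<bar>indicator {..A} y * ?G (x - y) - C * (indicator {..A} y * T (x - y))\<bar> \<le> D * (indicator {..A} y * T (x - y))"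
        by (simp add: indicator_def)
    qed
    also have "\<dots> = D * ?J A x" by simp
    finally have "\<bar>I - C * ?J A x\<bar> / T x \<le> D * ?J A x / T x"
      using Tx by (intro divide_right_mono) auto
    then have I: "\<bar>I / T x - C * (?J A x / T x)\<bar> \<le> D * (?J A x / T x)"
      using Tx by (simp add: diff_divide_distrib[symmetric] abs_divide)
    \<comment> \<open>Replacing \<open>C\<close> by \<open>phi * C + ?m\<close> pairs each piece
      with its own limit.\<close>
    have "?G x / T x - C = (I / T x - C * (?J A x / T x)) + C * (?J A x / T x - phi) + (?J' A x / T x - ?m) + R / T x"
      using split C(1) by (simp add: add_divide_distrib algebra_simps)
    moreover have "\<bar>C * (?J A x / T x - phi)\<bar> = C * \<bar>?J A x / T x - phi\<bar>"
      using C(2) by (simp add: abs_mult)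
    ultimately have "\<bar>?G x / T x - C\<bar> \<le> ?U x"
      using I R by linarith
    with elim(1) show ?case by linarith
  qed
qed

text \<open>The domination by \<open>K * T\<close> supplies a first error bound
  \<open>K + C\<close>; each use of the contraction multiplies it by \<open>phi\<close>, so finitely
  many uses bring it below any given \<open>e\<close>.\<close>

lemma fixed_point_tail_tendsto:
  assumes "phi < 1" "real_distribution N"
    and K: "\<And>x. upper_tail N x \<le> K * T x"
    and fp: "\<And>x. 0 \<le> x \<Longrightarrow> upper_tail N x = (\<integral>y. upper_tail N (x - y) \<partial>M)"
    and int: "integrable N (\<lambda>x. exp (\<gamma> * x))"
  shows "((\<lambda>x. upper_tail N x / T x) \<longlongrightarrow> (\<integral>x. exp (\<gamma> * x) \<partial>N) / (1 - phi)) at_top"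
proof (rule tendstoI)
  interpret N: real_distribution N by fact
  let ?G = "upper_tail N"
  define m where "m = (\<integral>x. exp (\<gamma> * x) \<partial>N)"
  define C where "C = m / (1 - phi)"
  have "0 \<le> m" unfolding m_def by (rule integral_nonneg_AE) simp
  then have C: "C = phi * C + m" "0 \<le> C"
    using assms(1) by (auto simp: C_def field_simps)
  have phi0: "0 \<le> phi" by (rule integral_nonneg_AE) simp
  fix e :: real assume e: "0 < e"
  have step: "\<forall>\<^sub>F x in at_top. \<bar>?G x / T x - C\<bar> \<le> phi ^ n * (K + C) + e / 2" for n
  proof (induction n)
    case 0
    have "\<bar>?G x / T x - C\<bar> \<le> K + C" for x
    proof -
      have "0 \<le> ?G x / T x" "?G x / T x \<le> K"
        using upper_tail_pos[of x] K[of x] by (auto simp: field_simps N.upper_tail_nonneg)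
      with C(2) show ?thesis by (simp add: abs_if)
    qed
    then show ?case
      using e by (intro always_eventually allI) (simp add: add_increasing2)
  next
    case (Suc n)
    \<comment> \<open>With slack \<open>(1 - phi) * (e / 2)\<close> the additive error reproduces
      itself, since \<open>phi * (e / 2) + (1 - phi) * (e / 2) = e / 2\<close>; it does not
      accumulate over the iterations.\<close>
    have "\<forall>\<^sub>F x in at_top. \<bar>?G x / T x - C\<bar> \<le> phi * (phi ^ n * (K + C) + e / 2) + (1 - phi) * (e / 2)"
      using fixed_point_tail_contraction[OF assms(2) K fp int C[unfolded m_def] Suc, of "(1 - phi) * (e / 2)"]
        e assms(1) by simp
    then show ?case by (simp add: algebra_simps add_divide_distrib)
  qed
  have "(\<lambda>n. phi ^ n * (K + C)) \<longlonglongrightarrow> 0 * (K + C)"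
    using phi0 assms(1) by (intro tendsto_intros LIMSEQ_power_zero) simp
  then have "\<forall>\<^sub>F n in sequentially. phi ^ n * (K + C) < e / 2"
    using e by (intro order_tendstoD(2)) auto
  then obtain n where n: "phi ^ n * (K + C) < e / 2"
    by (auto dest: eventually_happens)
  show "\<forall>\<^sub>F x in at_top. dist (?G x / T x) (m / (1 - phi)) < e"
    using step[of n]
  proof eventually_elim
    case (elim x)
    with n have "\<bar>?G x / T x - C\<bar> < e" by linarith
    then show ?case by (simp add: dist_real_def C_def)
  qed
qed

end

subsection \<open>The supremum of the random walk\<close>

definition partial_sum :: "nat \<Rightarrow> (nat \<Rightarrow> real) \<Rightarrow> real" where
  "partial_sum n s = (\<Sum>i<n. s i)"

text \<open>On a path unbounded above \<open>real_of_ereal\<close> returns 0, so the value is the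
  supremum only on bounded paths.\<close>

definition path_sup :: "(nat \<Rightarrow> real) \<Rightarrow> real" where
  "path_sup s = real_of_ereal (SUP n. ereal (partial_sum n s))"

lemma partial_sum_0 [simp]: "partial_sum 0 s = 0"
  by (simp add: partial_sum_def)

lemma partial_sum_Suc_case_nat: "partial_sum (Suc n) (case_nat y s) = y + partial_sum n s"
  by (simp only: partial_sum_def sum.lessThan_Suc_shift) simp

lemma path_sup_bounded:
  assumes "\<And>n. partial_sum n s \<le> B"
  shows "x < path_sup s \<longleftrightarrow> (\<exists>n. x < partial_sum n s)" "path_sup s \<le> B"
proof -
  let ?S = "SUP n. ereal (partial_sum n s)"
  have "?S \<le> ereal B" using assms by (intro SUP_least) simp
  moreover have "ereal (partial_sum 0 s) \<le> ?S" by (rule SUP_upper) simp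
  ultimately obtain r where r: "?S = ereal r" by (cases ?S) auto
  have "x < r \<longleftrightarrow> ereal x < ?S" unfolding r by simp
  also have "\<dots> \<longleftrightarrow> (\<exists>n. x < partial_sum n s)" by (simp add: less_SUP_iff)
  finally show "x < path_sup s \<longleftrightarrow> (\<exists>n. x < partial_sum n s)" by (simp add: path_sup_def r)
  show "path_sup s \<le> B"
    using \<open>?S \<le> ereal B\<close> by (simp add: path_sup_def r)
qed

lemma borel_measurable_partial_sum [measurable]:
  "partial_sum n \<in> borel_measurable (PiM UNIV (\<lambda>_. borel))"
  unfolding partial_sum_def by measurable

lemma borel_measurable_path_sup [measurable]:
  "path_sup \<in> borel_measurable (PiM UNIV (\<lambda>_. borel))"
  unfolding path_sup_def by measurable

section \<open>Canonical path space and the one-step recursions\<close>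

context real_distribution
begin

abbreviation "paths \<equiv> PiM UNIV (\<lambda>_::nat. M)"

lemma sequence_space: "sequence_space M"
  by (intro sequence_space.intro product_prob_spaceI prob_space_axioms)

lemma prob_space_paths: "prob_space paths"
  by (intro prob_space_PiM prob_space_axioms)

lemma sets_paths [measurable_cong]: "sets paths = sets (PiM UNIV (\<lambda>_. borel))"
  by (intro sets_PiM_cong) auto

lemma space_paths [simp]: "space paths = UNIV"
  by (simp add: space_PiM)

definition max_tail :: "nat \<Rightarrow> real \<Rightarrow> real" where
  "max_tail n x = measure paths {s. \<exists>j\<le>n. x < partial_sum j s}"

text \<open>Phrased by crossings and not by \<open>path_sup\<close>, so that the fixed point
  equation holds without knowing that paths are bounded.\<close>

definition sup_tail :: "real \<Rightarrow> real" where
  "sup_tail x = measure paths {s. \<exists>n. x < partial_sum n s}"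

lemma exceedance_sets:
  "{s. \<exists>j\<le>n. x < partial_sum j s} \<in> sets paths" "{s. \<exists>n. x < partial_sum n s} \<in> sets paths"
proof -
  have "{s \<in> space paths. \<exists>j\<le>n. x < partial_sum j s} \<in> sets paths" by measurable
  then show "{s. \<exists>j\<le>n. x < partial_sum j s} \<in> sets paths" by simp
  have "{s \<in> space paths. \<exists>n. x < partial_sum n s} \<in> sets paths" by measurable
  then show "{s. \<exists>n. x < partial_sum n s} \<in> sets paths" by simp
qed

lemma measurable_case_nat_paths: "(\<lambda>(y, s). case_nat y s) \<in> measurable (M \<Otimes>\<^sub>M paths) paths"
  by measurable

text \<open>Prepending an independent step to an i.i.d. sequence gives a sequence with the same law;
  conditioning on the first step is then Fubini.\<close>

lemma measure_paths_iter:
  assumes "E \<in> sets paths"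
  shows "measure paths E = (\<integral>y. measure paths {s. case_nat y s \<in> E} \<partial>M)"
proof -
  let ?f = "\<lambda>(y, s). case_nat y s :: nat \<Rightarrow> real"
  have "measure paths E = measure (distr (M \<Otimes>\<^sub>M paths) paths ?f) E"
    by (simp add: sequence_space.PiM_iter[OF sequence_space])
  also have "\<dots> = measure (M \<Otimes>\<^sub>M paths) (?f -` E \<inter> space (M \<Otimes>\<^sub>M paths))"
    by (intro measure_distr measurable_case_nat_paths assms)
  also have "\<dots> = (\<integral>y. measure paths (Pair y -` (?f -` E \<inter> space (M \<Otimes>\<^sub>M paths))) \<partial>M)"
    by (intro measure_pair_measure_fst prob_space_axioms prob_space_paths
        measurable_sets[OF measurable_case_nat_paths] assms)
  also have "\<dots> = (\<integral>y. measure paths {s. case_nat y s \<in> E} \<partial>M)"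
    by (intro Bochner_Integration.integral_cong arg_cong[where f="measure paths"])
      (auto simp: space_pair_measure)
  finally show ?thesis .
qed

text \<open>The walk starts at 0, so for \<open>x \<ge> 0\<close> it cannot have crossed at time 0;
  every crossing comes after the first step, and the remaining path has to cover
  \<open>x - y\<close>.\<close>

lemma exceedance_case_nat:
  assumes "0 \<le> x"
  shows "(\<exists>j\<le>Suc n. x < partial_sum j (case_nat y s)) \<longleftrightarrow> (\<exists>j\<le>n. x - y < partial_sum j s)"
    and "(\<exists>j. x < partial_sum j (case_nat y s)) \<longleftrightarrow> (\<exists>j. x - y < partial_sum j s)"
proof -
  have e: "(x < partial_sum j (case_nat y s)) \<longleftrightarrow> (\<exists>i. j = Suc i \<and> x - y < partial_sum i s)" for j
    using assms by (cases j) (auto simp: partial_sum_Suc_case_nat)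
  show "(\<exists>j\<le>Suc n. x < partial_sum j (case_nat y s)) \<longleftrightarrow> (\<exists>j\<le>n. x - y < partial_sum j s)"
    unfolding e by auto
  show "(\<exists>j. x < partial_sum j (case_nat y s)) \<longleftrightarrow> (\<exists>j. x - y < partial_sum j s)"
    unfolding e by auto
qed

lemma max_tail_Suc:
  assumes "0 \<le> x"
  shows "max_tail (Suc n) x = (\<integral>y. max_tail n (x - y) \<partial>M)"
  unfolding max_tail_def by (subst measure_paths_iter[OF exceedance_sets(1)])
    (simp only: mem_Collect_eq exceedance_case_nat(1)[OF assms])

lemma sup_tail_fixed_point:
  assumes "0 \<le> x"
  shows "sup_tail x = (\<integral>y. sup_tail (x - y) \<partial>M)"
  unfolding sup_tail_def by (subst measure_paths_iter[OF exceedance_sets(2)])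
    (simp only: mem_Collect_eq exceedance_case_nat(2)[OF assms])

lemma max_tail_0: "0 \<le> x \<Longrightarrow> max_tail 0 x = 0"
  by (simp add: max_tail_def)

lemma borel_measurable_max_tail: "max_tail n \<in> borel_measurable borel"
proof -
  interpret S: prob_space paths by (rule prob_space_paths)
  have "mono (\<lambda>x. - max_tail n x)"
    unfolding mono_def max_tail_def
    by (auto intro!: S.finite_measure_mono exceedance_sets(1) intro: le_less_trans)
  then have "(\<lambda>x. - max_tail n x) \<in> borel_measurable borel"
    by (rule borel_measurable_mono)
  from borel_measurable_uminus[OF this] show ?thesis by simp
qed

lemma sup_tail_antimono: "x \<le> y \<Longrightarrow> sup_tail y \<le> sup_tail x"
proof -
  interpret S: prob_space paths by (rule prob_space_paths)
  show "x \<le> y \<Longrightarrow> sup_tail y \<le> sup_tail x"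
    unfolding sup_tail_def by (intro S.finite_measure_mono exceedance_sets(2)) (auto intro: le_less_trans)
qed

lemma sup_tail_nonneg: "0 \<le> sup_tail x"
  by (simp add: sup_tail_def)

lemma borel_measurable_sup_tail [measurable]: "sup_tail \<in> borel_measurable borel"
proof -
  have "mono (\<lambda>x. - sup_tail x)"
    by (auto simp: mono_def sup_tail_antimono)
  then have "(\<lambda>x. - sup_tail x) \<in> borel_measurable borel"
    by (rule borel_measurable_mono)
  from borel_measurable_uminus[OF this] show ?thesis by simp
qed

lemma max_tail_tendsto: "(\<lambda>n. max_tail n x) \<longlonglongrightarrow> sup_tail x"
proof -
  interpret S: prob_space paths by (rule prob_space_paths)
  have "(\<lambda>n. measure paths {s. \<exists>j\<le>n. x < partial_sum j s}) \<longlonglongrightarrow>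
      measure paths (\<Union>n. {s. \<exists>j\<le>n. x < partial_sum j s})"
    using exceedance_sets(1) by (intro S.finite_Lim_measure_incseq) (auto simp: incseq_def intro: order_trans)
  also have "(\<Union>n. {s. \<exists>j\<le>n. x < partial_sum j s}) = {s. \<exists>n. x < partial_sum n s}"
    by auto
  finally show ?thesis by (simp add: max_tail_def sup_tail_def)
qed

lemma nn_integral_exp_partial_sum:
  "(\<integral>\<^sup>+s. ennreal (exp (c * partial_sum n s)) \<partial>paths) = (\<integral>\<^sup>+x. ennreal (exp (c * x)) \<partial>M) ^ n"
proof (induction n)
  case 0
  then show ?case
    using prob_space.emeasure_space_1[OF prob_space_paths] by simp
next
  case (Suc n)
  interpret S: prob_space paths by (rule prob_space_paths)
  let ?f = "\<lambda>(y, s). case_nat y s :: nat \<Rightarrow> real"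
  let ?e = "\<lambda>n s. ennreal (exp (c * partial_sum n s))"
  have "(\<integral>\<^sup>+s. ?e (Suc n) s \<partial>paths) = (\<integral>\<^sup>+s. ?e (Suc n) s \<partial>distr (M \<Otimes>\<^sub>M paths) paths ?f)"
    by (simp add: sequence_space.PiM_iter[OF sequence_space])
  also have "\<dots> = (\<integral>\<^sup>+p. ?e (Suc n) (?f p) \<partial>(M \<Otimes>\<^sub>M paths))"
    by (intro nn_integral_distr measurable_case_nat_paths) measurable
  also have "\<dots> = (\<integral>\<^sup>+p. ennreal (exp (c * fst p)) * ?e n (snd p) \<partial>(M \<Otimes>\<^sub>M paths))"
    by (intro nn_integral_cong)
      (auto simp: partial_sum_Suc_case_nat distrib_left exp_add ennreal_mult split_beta')
  also have "\<dots> = (\<integral>\<^sup>+y. \<integral>\<^sup>+s. ennreal (exp (c * y)) * ?e n s \<partial>paths \<partial>M)"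
    by (subst S.nn_integral_fst[symmetric]) (simp_all, measurable)
  also have "\<dots> = (\<integral>\<^sup>+y. ennreal (exp (c * y)) \<partial>M) * (\<integral>\<^sup>+s. ?e n s \<partial>paths)"
    by (simp add: nn_integral_cmult nn_integral_multc)
  finally show ?case using Suc by simp
qed

end

section \<open>Exponential moment and tail asymptotics of the supremum\<close>

context convolution_equivalent
begin

context
  assumes phi_less_1: "phi < 1"
begin

text \<open>The expectations \<open>phi ^ n\<close> form a convergent geometric series. The random
  series dominates every \<open>exp (\<gamma> * partial_sum n s)\<close> at once, which yields both
  boundedness of almost every path and integrability at the supremum.\<close>

lemma nn_integral_suminf_exp:
  "(\<integral>\<^sup>+s. (\<Sum>n. ennreal (exp (\<gamma> * partial_sum n s))) \<partial>paths) < \<infinity>"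
proof -
  have phi0: "0 \<le> phi" by (rule integral_nonneg_AE) simp
  have e: "(\<integral>\<^sup>+x. ennreal (exp (\<gamma> * x)) \<partial>M) = ennreal phi"
    using integrable_exp by (intro nn_integral_eq_integral) auto
  have "(\<integral>\<^sup>+s. (\<Sum>n. ennreal (exp (\<gamma> * partial_sum n s))) \<partial>paths) =
      (\<Sum>n. \<integral>\<^sup>+s. ennreal (exp (\<gamma> * partial_sum n s)) \<partial>paths)"
    by (rule nn_integral_suminf) measurable
  also have "\<dots> = (\<Sum>n. ennreal (phi ^ n))"
    by (simp only: nn_integral_exp_partial_sum e ennreal_power[OF phi0])
  also have "\<dots> = ennreal (\<Sum>n. phi ^ n)"
    using phi0 phi_less_1 by (intro suminf_ennreal2) auto
  finally show ?thesis by simp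
qed

lemma AE_paths_bounded:
  "AE s in paths. (\<forall>x. x < path_sup s \<longleftrightarrow> (\<exists>n. x < partial_sum n s)) \<and>
     ennreal (exp (\<gamma> * path_sup s)) \<le> (\<Sum>n. ennreal (exp (\<gamma> * partial_sum n s)))"
proof -
  have "AE s in paths. (\<Sum>n. ennreal (exp (\<gamma> * partial_sum n s))) \<noteq> \<infinity>"
  proof (rule nn_integral_noteq_infinite)
    show "(\<lambda>s. \<Sum>n. ennreal (exp (\<gamma> * partial_sum n s))) \<in> borel_measurable paths"
      by (intro borel_measurable_suminf_order) measurable
    show "(\<integral>\<^sup>+s. (\<Sum>n. ennreal (exp (\<gamma> * partial_sum n s))) \<partial>paths) \<noteq> \<infinity>"
      by (rule less_imp_neq[OF nn_integral_suminf_exp])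
  qed
  then show ?thesis
  proof eventually_elim
    case (elim s)
    define Z where "Z = (\<Sum>n. ennreal (exp (\<gamma> * partial_sum n s)))"
    obtain c where c: "Z = ennreal c" "0 \<le> c"
      using elim[folded Z_def] by (cases Z) auto
    have le: "exp (\<gamma> * partial_sum n s) \<le> c" for n
    proof -
      have "(\<Sum>i\<in>{n}. ennreal (exp (\<gamma> * partial_sum i s))) \<le> Z"
        unfolding Z_def by (rule sum_le_suminf) (simp_all only: summableI finite.intros zero_le)
      then show ?thesis using c by simp
    qed
    \<comment> \<open>The term for \<open>n = 0\<close> equals 1, so \<open>ln c\<close> is
      meaningful.\<close>
    have c0: "0 < c" using le[of 0] by simp
    have "partial_sum n s \<le> ln c / \<gamma>" for n
    proof -
      have "\<gamma> * partial_sum n s \<le> ln c"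
        using le[of n] c0 by (simp add: ln_ge_iff)
      then show ?thesis using \<gamma>_pos by (simp add: field_simps)
    qed
    note b = path_sup_bounded[OF this]
    have "\<gamma> * path_sup s \<le> ln c" using b(2) \<gamma>_pos by (simp add: field_simps)
    then have "exp (\<gamma> * path_sup s) \<le> c" using c0 by (simp add: ln_ge_iff)
    then show ?case unfolding Z_def[symmetric] using b(1) c by (simp add: ennreal_leI)
  qed
qed

lemma integrable_exp_path_sup: "integrable paths (\<lambda>s. exp (\<gamma> * path_sup s))"
proof (rule integrableI_bounded)
  have "(\<integral>\<^sup>+s. ennreal (norm (exp (\<gamma> * path_sup s))) \<partial>paths) \<le>
      (\<integral>\<^sup>+s. (\<Sum>n. ennreal (exp (\<gamma> * partial_sum n s))) \<partial>paths)"
    by (rule nn_integral_mono_AE, use AE_paths_bounded in eventually_elim) (simp only: real_norm_def abs_exp_cancel)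
  also note nn_integral_suminf_exp
  finally show "(\<integral>\<^sup>+s. ennreal (norm (exp (\<gamma> * path_sup s))) \<partial>paths) < \<infinity>" .
qed measurable

text \<open>Kesten's constant does not depend on \<open>n\<close> and so survives the limit of the
  finite maxima.\<close>

lemma sup_tail_bound: obtains K where "\<And>x. sup_tail x \<le> K * T x" "0 \<le> K"
proof -
  obtain K where K: "\<And>n x. max_tail n x \<le> K * T x" "0 \<le> K"
  proof (rule kesten_bound[OF phi_less_1, of max_tail])
    show "max_tail n x \<le> 1" for n x
      unfolding max_tail_def by (rule prob_space.prob_le_1[OF prob_space_paths])
  qed (auto simp: max_tail_0 max_tail_Suc borel_measurable_max_tail, simp add: max_tail_def)
  have "sup_tail x \<le> K * T x" for x
    by (rule LIMSEQ_le_const2[OF max_tail_tendsto]) (use K in auto)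
  with K that show ?thesis by blast
qed

text \<open>The fixed point lemma speaks of a law on the reals, so the law of
  \<open>path_sup\<close> is inserted; its tail is \<open>sup_tail\<close> because the two events
  differ only on the null set of bad paths.\<close>

lemma sup_tail_tendsto:
  "((\<lambda>x. sup_tail x / T x) \<longlongrightarrow> (\<integral>s. exp (\<gamma> * path_sup s) \<partial>paths) / (1 - phi)) at_top"
proof -
  interpret S: prob_space paths by (rule prob_space_paths)
  define N where "N = distr paths borel path_sup"
  have N: "real_distribution N"
    unfolding N_def by (intro S.real_distribution_distr) measurable
  have tail: "upper_tail N x = sup_tail x" for x
  proof -
    have "upper_tail N x = measure paths {s. x < path_sup s}"
      unfolding upper_tail_def N_def
      by (subst measure_distr) (auto intro!: arg_cong[where f="measure paths"])
    also have "\<dots> = sup_tail x"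
      unfolding sup_tail_def
    proof (rule S.finite_measure_eq_AE)
      show "AE s in paths. (s \<in> {s. x < path_sup s}) = (s \<in> {s. \<exists>n. x < partial_sum n s})"
        using AE_paths_bounded by eventually_elim simp
      have "{s \<in> space paths. x < path_sup s} \<in> sets paths" by measurable
      then show "{s. x < path_sup s} \<in> sets paths" by simp
    qed (rule exceedance_sets)
    finally show ?thesis .
  qed
  obtain K where K: "\<And>x. sup_tail x \<le> K * T x" using sup_tail_bound by blast
  have "((\<lambda>x. upper_tail N x / T x) \<longlongrightarrow> (\<integral>x. exp (\<gamma> * x) \<partial>N) / (1 - phi)) at_top"
  proof (rule fixed_point_tail_tendsto[OF phi_less_1 N])
    show "upper_tail N x \<le> K * T x" for x by (simp add: tail K)
    show "upper_tail N x = (\<integral>y. upper_tail N (x - y) \<partial>M)" if "0 \<le> x" for x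
      unfolding tail using that by (rule sup_tail_fixed_point)
    show "integrable N (\<lambda>x. exp (\<gamma> * x))"
      unfolding N_def by (subst integrable_distr_eq) (auto simp: integrable_exp_path_sup)
  qed
  moreover have "(\<integral>x. exp (\<gamma> * x) \<partial>N) = (\<integral>s. exp (\<gamma> * path_sup s) \<partial>paths)"
    unfolding N_def by (rule integral_distr) auto
  ultimately show ?thesis by (simp add: tail)
qed

end

end

subsection \<open>Stopping the walk\<close>

lemma space_walk_filtration [simp]: "space (walk_filtration P \<xi> t) = space P"
  by (simp add: walk_filtration_def space_measure_of_conv)

lemma sets_walk_filtration:
  "sets (walk_filtration P \<xi> t) =
    sigma_sets (space P) {walk \<xi> k -` A \<inter> space P | k A. enat k \<le> t \<and> A \<in> sets borel}"
  unfolding walk_filtration_def by (rule sets_measure_of) auto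

lemma walk_filtration_mono: "s \<le> t \<Longrightarrow> sets (walk_filtration P \<xi> s) \<subseteq> sets (walk_filtration P \<xi> t)"
  unfolding sets_walk_filtration by (intro sigma_sets_mono') (blast intro: order_trans)

lemma walk_measurable_walk_filtration:
  assumes "enat k \<le> t"
  shows "walk \<xi> k \<in> borel_measurable (walk_filtration P \<xi> t)"
proof (rule measurableI)
  fix A :: "real set" assume "A \<in> sets borel"
  with assms show "walk \<xi> k -` A \<inter> space (walk_filtration P \<xi> t) \<in> sets (walk_filtration P \<xi> t)"
    unfolding sets_walk_filtration space_walk_filtration by (intro sigma_sets.Basic) blast
qed simp

lemma walk_max_measurable_walk_filtration:
  "walk_max \<xi> k \<in> borel_measurable (walk_filtration P \<xi> (enat k))"
  unfolding walk_max_def by (intro borel_measurable_Max walk_measurable_walk_filtration) auto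

lemma walk_max_le_iff: "walk_max \<xi> k \<omega> \<le> x \<longleftrightarrow> (\<forall>i\<le>k. walk \<xi> i \<omega> \<le> x)"
  by (auto simp: walk_max_def)

lemma less_walk_max_iff: "x < walk_max \<xi> k \<omega> \<longleftrightarrow> (\<exists>i\<le>k. x < walk \<xi> i \<omega>)"
  using walk_max_le_iff[of \<xi> k \<omega> x] by (auto simp: not_le[symmetric])

lemma stopping_time_walk_sets:
  assumes "stopping_time (walk_filtration P \<xi>) \<sigma>"
  shows "{\<omega> \<in> space P. \<sigma> \<omega> = enat k} \<in> sets (walk_filtration P \<xi> (enat k))"
proof -
  let ?F = "walk_filtration P \<xi> (enat k)"
  have le: "{\<omega> \<in> space P. \<sigma> \<omega> \<le> enat j} \<in> sets ?F" if "j \<le> k" for j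
    using stopping_timeD[OF assms, of "enat j"] walk_filtration_mono[of "enat j" "enat k" P \<xi>] that
    by (auto simp: pred_def)
  have "{\<omega> \<in> space P. \<sigma> \<omega> = enat k} =
      {\<omega> \<in> space P. \<sigma> \<omega> \<le> enat k} - (\<Union>j<k. {\<omega> \<in> space P. \<sigma> \<omega> \<le> enat j})"
  proof (intro set_eqI iffI)
    fix \<omega> assume \<omega>: "\<omega> \<in> {\<omega> \<in> space P. \<sigma> \<omega> \<le> enat k} - (\<Union>j<k. {\<omega> \<in> space P. \<sigma> \<omega> \<le> enat j})"
    then have "\<sigma> \<omega> \<le> enat k" by simp
    then obtain m where m: "\<sigma> \<omega> = enat m" "m \<le> k" by (cases "\<sigma> \<omega>") auto
    with \<omega> have "\<not> m < k" by auto
    with m \<omega> show "\<omega> \<in> {\<omega> \<in> space P. \<sigma> \<omega> = enat k}" by auto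
  qed auto
  also have "\<dots> \<in> sets ?F"
    by (intro sets.Diff sets.countable_UN' le) (auto simp: le)
  finally show ?thesis .
qed

text \<open>Restriction to \<open>{1..k}\<close> makes this a point of a finite product space, the
  form in which independence of disjoint blocks of steps is stated. \<open>walk_future\<close> is
  reindexed from 0 to match \<open>partial_sum\<close>.\<close>

definition walk_past :: "(nat \<Rightarrow> 'a \<Rightarrow> real) \<Rightarrow> nat \<Rightarrow> 'a \<Rightarrow> nat \<Rightarrow> real" where
  "walk_past \<xi> k \<omega> = restrict (\<lambda>i. \<xi> i \<omega>) {1..k}"

definition walk_future :: "(nat \<Rightarrow> 'a \<Rightarrow> real) \<Rightarrow> nat \<Rightarrow> 'a \<Rightarrow> nat \<Rightarrow> real" where
  "walk_future \<xi> k \<omega> = (\<lambda>i. \<xi> (k + 1 + i) \<omega>)"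

lemma walk_eq_past: "j \<le> k \<Longrightarrow> walk \<xi> j \<omega> = (\<Sum>i=1..j. walk_past \<xi> k \<omega> i)"
  unfolding walk_def walk_past_def by (intro sum.cong) auto

lemma walk_add: "walk \<xi> (k + m) \<omega> = walk \<xi> k \<omega> + partial_sum m (walk_future \<xi> k \<omega>)"
  by (induction m) (auto simp: walk_def walk_future_def partial_sum_def)

section \<open>Independence of past and future, and the Markov property at a fixed time\<close>

locale iid_walk = real_distribution M + P: prob_space P
  for M :: "real measure" and P :: "'a measure" +
  fixes \<xi> :: "nat \<Rightarrow> 'a \<Rightarrow> real"
  assumes indep_steps: "P.indep_vars (\<lambda>_. borel) \<xi> {1..}"
    and step_law: "1 \<le> n \<Longrightarrow> distr P borel (\<xi> n) = M"
begin

lemma measurable_step: "1 \<le> n \<Longrightarrow> \<xi> n \<in> borel_measurable P"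
  using indep_steps by (auto simp: P.indep_vars_def)

lemma measurable_walk [measurable]: "walk \<xi> n \<in> borel_measurable P"
  unfolding walk_def by (intro borel_measurable_sum measurable_step) auto

lemma measurable_walk_max [measurable]: "walk_max \<xi> n \<in> borel_measurable P"
  unfolding walk_max_def by (intro borel_measurable_Max measurable_walk) auto

lemma measurable_walk_past [measurable]: "walk_past \<xi> k \<in> measurable P (PiM {1..k} (\<lambda>_. borel))"
  unfolding walk_past_def by (intro measurable_restrict measurable_step) auto

lemma measurable_walk_future [measurable]: "walk_future \<xi> k \<in> measurable P (PiM UNIV (\<lambda>_. borel))"
  unfolding walk_future_def by (rule measurable_PiM_single') (auto intro: measurable_step)

lemma sets_walk_filtration_subset: "sets (walk_filtration P \<xi> t) \<subseteq> sets P"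
  unfolding sets_walk_filtration
proof (rule sets.sigma_sets_subset, clarify)
  fix k and A :: "real set" assume "A \<in> sets borel"
  then show "walk \<xi> k -` A \<inter> space P \<in> sets P" by (rule measurable_sets[OF measurable_walk])
qed

text \<open>Each generating event concerns a sum of the first steps, so it is a preimage under
  \<open>walk_past\<close>, and preimages form a sigma-algebra.\<close>

lemma walk_filtration_past:
  assumes "A \<in> sets (walk_filtration P \<xi> (enat k))"
  obtains B where "B \<in> sets (PiM {1..k} (\<lambda>_. borel))" "A = walk_past \<xi> k -` B \<inter> space P"
proof -
  let ?V = "vimage_algebra (space P) (walk_past \<xi> k) (PiM {1..k} (\<lambda>_. borel))"
  have V: "sets ?V = {walk_past \<xi> k -` B \<inter> space P | B. B \<in> sets (PiM {1..k} (\<lambda>_. borel))}"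
    by (intro sets_vimage_algebra2) (use measurable_walk_past in \<open>auto simp: measurable_def\<close>)
  have "sigma_sets (space ?V) {walk \<xi> j -` A \<inter> space P | j A. enat j \<le> enat k \<and> A \<in> sets borel} \<subseteq> sets ?V"
  proof (rule sets.sigma_sets_subset, clarify)
    fix j and A :: "real set" assume j: "enat j \<le> enat k" and A: "A \<in> sets borel"
    let ?w = "\<lambda>s. \<Sum>i=1..j. s i :: real"
    have "?w \<in> borel_measurable (PiM {1..k} (\<lambda>_. borel))"
      using j by (intro borel_measurable_sum measurable_component_singleton) auto
    from measurable_sets[OF this A]
    have "walk_past \<xi> k -` (?w -` A \<inter> space (PiM {1..k} (\<lambda>_. borel))) \<inter> space P \<in> sets ?V"
      unfolding V by blast
    also have "walk_past \<xi> k -` (?w -` A \<inter> space (PiM {1..k} (\<lambda>_. borel))) \<inter> space P = walk \<xi> j -` A \<inter> space P"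
      using j measurable_space[OF measurable_walk_past[of k]]
      by (auto simp: walk_eq_past[of j k])
    finally show "walk \<xi> j -` A \<inter> space P \<in> sets ?V" .
  qed
  with assms have "A \<in> sets ?V" by (auto simp: sets_walk_filtration)
  with V that show ?thesis by auto
qed

lemma walk_future_law: "distr P (PiM UNIV (\<lambda>_. borel)) (walk_future \<xi> k) = paths"
proof -
  let ?I = "{k + 1..}"
  let ?f = "\<lambda>s. \<lambda>n\<in>UNIV. s (k + 1 + n) :: real"
  have ind: "P.indep_vars (\<lambda>_. borel) \<xi> ?I"
    by (rule P.indep_vars_subset[OF indep_steps]) auto
  have "distr P (PiM ?I (\<lambda>_. borel)) (\<lambda>\<omega>. \<lambda>i\<in>?I. \<xi> i \<omega>) = PiM ?I (\<lambda>i. distr P borel (\<xi> i))"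
    using ind by (subst (asm) P.indep_vars_iff_distr_eq_PiM') (auto intro: measurable_step)
  also have "\<dots> = PiM ?I (\<lambda>_. M)"
    by (intro PiM_cong step_law) auto
  finally have law: "distr P (PiM ?I (\<lambda>_. borel)) (\<lambda>\<omega>. \<lambda>i\<in>?I. \<xi> i \<omega>) = PiM ?I (\<lambda>_. M)" .
  have f: "?f \<in> measurable (PiM ?I (\<lambda>_. borel)) (PiM UNIV (\<lambda>_. borel))"
    by (intro measurable_restrict measurable_component_singleton) auto
  have m: "(\<lambda>\<omega>. \<lambda>i\<in>?I. \<xi> i \<omega>) \<in> measurable P (PiM ?I (\<lambda>_. borel))"
    by (intro measurable_restrict measurable_step) auto
  have "paths = distr (PiM ?I (\<lambda>_. M)) paths ?f"
    by (rule distr_PiM_reindex[symmetric]) (auto simp: inj_on_def intro: prob_space_axioms)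
  also have "\<dots> = distr (PiM ?I (\<lambda>_. M)) (PiM UNIV (\<lambda>_. borel)) ?f"
    by (intro distr_cong sets_paths) auto
  also have "\<dots> = distr P (PiM UNIV (\<lambda>_. borel)) (?f \<circ> (\<lambda>\<omega>. \<lambda>i\<in>?I. \<xi> i \<omega>))"
    unfolding law[symmetric] by (rule distr_distr[OF f m])
  also have "?f \<circ> (\<lambda>\<omega>. \<lambda>i\<in>?I. \<xi> i \<omega>) = walk_future \<xi> k"
    by (auto simp: walk_future_def fun_eq_iff)
  finally show ?thesis by simp
qed

lemma indep_past_future:
  "P.indep_var (PiM {1..k} (\<lambda>_. borel)) (walk_past \<xi> k) (PiM UNIV (\<lambda>_. borel)) (walk_future \<xi> k)"
proof -
  let ?I = "{k + 1..}"
  let ?f = "\<lambda>s. \<lambda>n\<in>UNIV. s (k + 1 + n) :: real"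
  have "P.indep_var (PiM {1..k} (\<lambda>_. borel)) (\<lambda>\<omega>. restrict (\<lambda>i. \<xi> i \<omega>) {1..k})
      (PiM ?I (\<lambda>_. borel)) (\<lambda>\<omega>. restrict (\<lambda>i. \<xi> i \<omega>) ?I)"
    by (rule P.indep_var_restrict[OF indep_steps]) auto
  moreover have "?f \<in> measurable (PiM ?I (\<lambda>_. borel)) (PiM UNIV (\<lambda>_. borel))"
    by (intro measurable_restrict measurable_component_singleton) auto
  ultimately have "P.indep_var (PiM {1..k} (\<lambda>_. borel)) ((\<lambda>s. s) \<circ> (\<lambda>\<omega>. restrict (\<lambda>i. \<xi> i \<omega>) {1..k}))
      (PiM UNIV (\<lambda>_. borel)) (?f \<circ> (\<lambda>\<omega>. restrict (\<lambda>i. \<xi> i \<omega>) ?I))"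
    by (intro P.indep_var_compose) auto
  moreover have "?f \<circ> (\<lambda>\<omega>. restrict (\<lambda>i. \<xi> i \<omega>) ?I) = walk_future \<xi> k"
    by (auto simp: walk_future_def fun_eq_iff)
  moreover have "(\<lambda>s. s) \<circ> (\<lambda>\<omega>. restrict (\<lambda>i. \<xi> i \<omega>) {1..k}) = walk_past \<xi> k"
    by (auto simp: walk_past_def fun_eq_iff)
  ultimately show ?thesis by simp
qed

text \<open>By independence the pair has a product law, so the past may be frozen while the future
  is averaged over fresh paths.\<close>

lemma emeasure_past_future:
  assumes Q: "Measurable.pred (PiM {1..k} (\<lambda>_. borel) \<Otimes>\<^sub>M PiM UNIV (\<lambda>_. borel)) Q"
  shows "emeasure P {\<omega> \<in> space P. Q (walk_past \<xi> k \<omega>, walk_future \<xi> k \<omega>)} =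
    (\<integral>\<^sup>+\<omega>. emeasure paths {s. Q (walk_past \<xi> k \<omega>, s)} \<partial>P)"
proof -
  interpret S: prob_space paths by (rule prob_space_paths)
  let ?A = "PiM {1..k} (\<lambda>_. borel :: real measure)" and ?B = "PiM UNIV (\<lambda>_::nat. borel :: real measure)"
  let ?E = "{p \<in> space (?A \<Otimes>\<^sub>M ?B). Q p}"
  let ?f = "\<lambda>\<omega>. (walk_past \<xi> k \<omega>, walk_future \<xi> k \<omega>)"
  have E: "?E \<in> sets (?A \<Otimes>\<^sub>M ?B)" using Q by (simp add: pred_def)
  have s: "sets (?A \<Otimes>\<^sub>M paths) = sets (?A \<Otimes>\<^sub>M ?B)"
    by (intro sets_pair_measure_cong sets_paths refl)
  have E': "?E \<in> sets (distr P ?A (walk_past \<xi> k) \<Otimes>\<^sub>M paths)"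
    using E sets_pair_measure_cong[OF sets_distr[of P ?A "walk_past \<xi> k"] sets_paths] by simp
  have f: "?f \<in> measurable P (?A \<Otimes>\<^sub>M ?B)" by measurable
  have "emeasure P {\<omega> \<in> space P. Q (?f \<omega>)} = emeasure (distr P (?A \<Otimes>\<^sub>M ?B) ?f) ?E"
    using measurable_space[OF f] by (subst emeasure_distr[OF f E]) (auto intro!: arg_cong[where f="emeasure P"])
  also have "distr P (?A \<Otimes>\<^sub>M ?B) ?f = distr P ?A (walk_past \<xi> k) \<Otimes>\<^sub>M paths"
    using indep_past_future[of k] by (simp add: P.indep_var_distribution_eq walk_future_law)
  also have "emeasure (distr P ?A (walk_past \<xi> k) \<Otimes>\<^sub>M paths) ?E =
      (\<integral>\<^sup>+t. emeasure paths (Pair t -` ?E) \<partial>distr P ?A (walk_past \<xi> k))"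
    by (rule S.emeasure_pair_measure_alt[OF E'])
  also have "\<dots> = (\<integral>\<^sup>+\<omega>. emeasure paths (Pair (walk_past \<xi> k \<omega>) -` ?E) \<partial>P)"
    using E s by (intro nn_integral_distr measurable_walk_past S.measurable_emeasure_Pair) simp
  also have "\<dots> = (\<integral>\<^sup>+\<omega>. emeasure paths {s. Q (walk_past \<xi> k \<omega>, s)} \<partial>P)"
    using measurable_space[OF measurable_walk_past[of k]]
    by (intro nn_integral_cong arg_cong[where f="emeasure paths"]) (auto simp: space_pair_measure space_PiM)
  finally show ?thesis .
qed

text \<open>Both \<open>A\<close> and \<open>walk \<xi> k\<close> are functions of the past. Once it
  is frozen, what remains is that a fresh path exceeds
  \<open>x - walk \<xi> k \<omega>\<close>.\<close>

lemma emeasure_crossing_after: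
  assumes "A \<in> sets (walk_filtration P \<xi> (enat k))"
  shows "emeasure P {\<omega> \<in> A. \<exists>m. x < walk \<xi> (k + m) \<omega>} =
    (\<integral>\<^sup>+\<omega>. indicator A \<omega> * ennreal (sup_tail (x - walk \<xi> k \<omega>)) \<partial>P)"
proof -
  interpret S: prob_space paths by (rule prob_space_paths)
  obtain B where B: "B \<in> sets (PiM {1..k} (\<lambda>_. borel))" "A = walk_past \<xi> k -` B \<inter> space P"
    using walk_filtration_past[OF assms] .
  note [measurable] = B(1)
  define w where "w s = (\<Sum>i=1..k. s i :: real)" for s
  have [measurable]: "w \<in> borel_measurable (PiM {1..k} (\<lambda>_. borel))"
    unfolding w_def by (intro borel_measurable_sum measurable_component_singleton)
  have w: "w (walk_past \<xi> k \<omega>) = walk \<xi> k \<omega>" for \<omega>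
    by (simp add: w_def walk_eq_past[of k k])
  let ?Q = "\<lambda>p. fst p \<in> B \<and> (\<exists>m. x < w (fst p) + partial_sum m (snd p))"
  have Q: "Measurable.pred (PiM {1..k} (\<lambda>_. borel) \<Otimes>\<^sub>M PiM UNIV (\<lambda>_. borel)) ?Q"
    by measurable
  have "{\<omega> \<in> A. \<exists>m. x < walk \<xi> (k + m) \<omega>} =
      {\<omega> \<in> space P. ?Q (walk_past \<xi> k \<omega>, walk_future \<xi> k \<omega>)}"
    by (auto simp: B(2) w walk_add)
  then have "emeasure P {\<omega> \<in> A. \<exists>m. x < walk \<xi> (k + m) \<omega>} =
      (\<integral>\<^sup>+\<omega>. emeasure paths {s. ?Q (walk_past \<xi> k \<omega>, s)} \<partial>P)"
    by (simp only: emeasure_past_future[OF Q])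
  also have "\<dots> = (\<integral>\<^sup>+\<omega>. indicator A \<omega> * ennreal (sup_tail (x - walk \<xi> k \<omega>)) \<partial>P)"
  proof (intro nn_integral_cong)
    fix \<omega> assume "\<omega> \<in> space P"
    then have "{s. ?Q (walk_past \<xi> k \<omega>, s)} =
        (if \<omega> \<in> A then {s. \<exists>m. x - walk \<xi> k \<omega> < partial_sum m s} else {})"
      by (auto simp: B(2) w algebra_simps)
    then show "emeasure paths {s. ?Q (walk_past \<xi> k \<omega>, s)} =
        indicator A \<omega> * ennreal (sup_tail (x - walk \<xi> k \<omega>))"
      by (simp add: sup_tail_def S.emeasure_eq_measure)
  qed
  finally show ?thesis .
qed

lemma measure_walk_crossing: "measure P {\<omega> \<in> space P. \<exists>n. x < walk \<xi> n \<omega>} = sup_tail x"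
proof -
  have "sup_tail x = measure (distr P (PiM UNIV (\<lambda>_. borel)) (walk_future \<xi> 0)) {s. \<exists>n. x < partial_sum n s}"
    by (simp add: sup_tail_def walk_future_law)
  also have "\<dots> = measure P (walk_future \<xi> 0 -` {s. \<exists>n. x < partial_sum n s} \<inter> space P)"
    using exceedance_sets(2) sets_paths by (intro measure_distr measurable_walk_future) simp
  also have "walk_future \<xi> 0 -` {s. \<exists>n. x < partial_sum n s} \<inter> space P = {\<omega> \<in> space P. \<exists>n. x < walk \<xi> n \<omega>}"
    using walk_add[of \<xi> 0] by (auto simp: walk_def)
  finally show ?thesis by simp
qed

text \<open>Both sides pass through \<open>real_of_ereal\<close>, so the identity holds on every
  path, unbounded ones included.\<close>

lemma path_sup_walk_future: "path_sup (walk_future \<xi> 0 \<omega>) = real_of_ereal (walk_sup \<xi> \<omega>)"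
  using walk_add[of \<xi> 0] by (simp add: path_sup_def walk_sup_def walk_def)

lemma integral_exp_walk_sup:
  "(\<integral>\<omega>. exp (c * real_of_ereal (walk_sup \<xi> \<omega>)) \<partial>P) = (\<integral>s. exp (c * path_sup s) \<partial>paths)"
  unfolding walk_future_law[of 0, symmetric] path_sup_walk_future[symmetric]
  by (rule integral_distr[symmetric]) measurable

section \<open>The strong Markov property at the stopping time\<close>

context
  fixes \<sigma> :: "'a \<Rightarrow> enat"
  assumes stop: "stopping_time (walk_filtration P \<xi>) \<sigma>"
begin

lemma measurable_stopping [measurable]: "\<sigma> \<in> measurable P (count_space UNIV)"
  unfolding measurable_count_space_eq2_countable
proof (intro conjI ballI)
  have fin: "{\<omega> \<in> space P. \<sigma> \<omega> = enat k} \<in> sets P" for k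
    using stopping_time_walk_sets[OF stop] sets_walk_filtration_subset by blast
  fix a :: enat
  show "\<sigma> -` {a} \<inter> space P \<in> sets P"
  proof (cases a)
    case (enat k)
    then show ?thesis using fin[of k] by (simp add: vimage_def Int_def conj_commute)
  next
    case infinity
    have "\<sigma> -` {a} \<inter> space P = space P - (\<Union>k. {\<omega> \<in> space P. \<sigma> \<omega> = enat k})"
      using infinity by auto
    also have "\<dots> \<in> sets P" using fin by (intro sets.Diff sets.countable_UN) auto
    finally show ?thesis .
  qed
qed auto

lemma measurable_stopped:
  assumes "\<And>n. f n \<in> borel_measurable P"
  shows "(\<lambda>\<omega>. f (the_enat (\<sigma> \<omega>)) \<omega>) \<in> borel_measurable P"
  by (rule measurable_compose_countable[where f="\<lambda>i. f (the_enat i)", OF assms measurable_stopping])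

lemma measurable_stopped_walk [measurable]:
  "(\<lambda>\<omega>. walk \<xi> (the_enat (\<sigma> \<omega>)) \<omega>) \<in> borel_measurable P"
  "(\<lambda>\<omega>. walk_max \<xi> (the_enat (\<sigma> \<omega>)) \<omega>) \<in> borel_measurable P"
  by (rule measurable_stopped, measurable)+

text \<open>The strong Markov property at \<open>\<sigma>\<close>: a path that crosses \<open>x\<close> only after time \<open>\<sigma>\<close> has to make
  up the remaining distance \<open>x - S\<^sub>\<sigma>\<close> afterwards.\<close>

lemma measure_stopped_max:
  assumes fin: "AE \<omega> in P. \<sigma> \<omega> < \<infinity>"
  shows "measure P {\<omega> \<in> space P. x < walk_max \<xi> (the_enat (\<sigma> \<omega>)) \<omega>} =
    sup_tail x - (\<integral>\<omega>. indicator {..x} (walk_max \<xi> (the_enat (\<sigma> \<omega>)) \<omega>) *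
      sup_tail (x - walk \<xi> (the_enat (\<sigma> \<omega>)) \<omega>) \<partial>P)"
proof -
  let ?U = "{\<omega> \<in> space P. \<exists>n. x < walk \<xi> n \<omega>}"
  let ?V = "{\<omega> \<in> space P. x < walk_max \<xi> (the_enat (\<sigma> \<omega>)) \<omega>}"
  \<comment> \<open>Fixing the value of \<open>\<sigma>\<close> turns its stopped maximum into
    \<open>walk_max \<xi> k\<close>, so \<open>A k\<close> is known at time \<open>k\<close> and the
    Markov property at time \<open>k\<close> applies.\<close>
  define A where "A k = {\<omega> \<in> space P. \<sigma> \<omega> = enat k \<and> walk_max \<xi> k \<omega> \<le> x}" for k
  define W where "W k = {\<omega> \<in> A k. \<exists>m. x < walk \<xi> (k + m) \<omega>}" for k
  let ?f = "\<lambda>\<omega>. indicator {..x} (walk_max \<xi> (the_enat (\<sigma> \<omega>)) \<omega>) * sup_tail (x - walk \<xi> (the_enat (\<sigma> \<omega>)) \<omega>)"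
  have AF: "A k \<in> sets (walk_filtration P \<xi> (enat k))" for k
  proof -
    let ?F = "walk_filtration P \<xi> (enat k)"
    have "{\<omega> \<in> space ?F. walk_max \<xi> k \<omega> \<le> x} \<in> sets ?F"
      by (intro borel_measurable_le walk_max_measurable_walk_filtration) auto
    from sets.Int[OF stopping_time_walk_sets[OF stop] this]
    show ?thesis by (simp add: A_def Int_def conj_ac cong: conj_cong)
  qed
  then have A [measurable]: "A k \<in> sets P" for k
    using sets_walk_filtration_subset by blast
  have W: "W k \<in> sets P" for k
  proof -
    have "W k = A k \<inter> {\<omega> \<in> space P. \<exists>m. x < walk \<xi> (k + m) \<omega>}"
      by (auto simp: W_def A_def)
    also have "\<dots> \<in> sets P" by measurable
    finally show ?thesis .
  qed
  have U: "?U \<in> sets P" and V: "?V \<in> sets P" by measurable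
  \<comment> \<open>\<open>?U - ?V\<close> is the event of crossing \<open>x\<close>, but only after
    \<open>\<sigma>\<close>. Where \<open>\<sigma>\<close> is finite the disjoint sets
    \<open>W k\<close> partition it.\<close>
  have "emeasure P (?U - ?V) = emeasure P (\<Union>k. W k)"
  proof (rule emeasure_eq_AE)
    show "AE \<omega> in P. (\<omega> \<in> ?U - ?V) = (\<omega> \<in> (\<Union>k. W k))"
      using fin AE_space
    proof eventually_elim
      case (elim \<omega>)
      then obtain k where k: "\<sigma> \<omega> = enat k" by auto
      have "(\<exists>n. x < walk \<xi> n \<omega>) \<longleftrightarrow> (\<exists>m. x < walk \<xi> (k + m) \<omega>)" if "walk_max \<xi> k \<omega> \<le> x"
      proof
        assume "\<exists>n. x < walk \<xi> n \<omega>"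
        then obtain n where n: "x < walk \<xi> n \<omega>" ..
        with that have "\<not> n \<le> k" by (metis less_walk_max_iff not_le)
        then have "k + (n - k) = n" by simp
        with n show "\<exists>m. x < walk \<xi> (k + m) \<omega>" by metis
      qed blast
      with k elim(2) show ?case by (auto simp: W_def A_def not_less)
    qed
  qed (use U V W in auto)
  also have "\<dots> = (\<Sum>k. emeasure P (W k))"
    by (rule suminf_emeasure[symmetric]) (use W in \<open>auto simp: disjoint_family_on_def W_def A_def\<close>)
  also have "\<dots> = (\<Sum>k. \<integral>\<^sup>+\<omega>. indicator (A k) \<omega> * ennreal (sup_tail (x - walk \<xi> k \<omega>)) \<partial>P)"
    unfolding W_def by (simp only: emeasure_crossing_after[OF AF])
  also have "\<dots> = (\<integral>\<^sup>+\<omega>. (\<Sum>k. indicator (A k) \<omega> * ennreal (sup_tail (x - walk \<xi> k \<omega>))) \<partial>P)"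
    by (rule nn_integral_suminf[symmetric]) measurable
  also have "\<dots> = (\<integral>\<^sup>+\<omega>. ennreal (?f \<omega>) \<partial>P)"
  proof (rule nn_integral_cong_AE)
    show "AE \<omega> in P. (\<Sum>k. indicator (A k) \<omega> * ennreal (sup_tail (x - walk \<xi> k \<omega>))) = ennreal (?f \<omega>)"
      using fin AE_space
    proof eventually_elim
      case (elim \<omega>)
      then obtain k where k: "\<sigma> \<omega> = enat k" by auto
      \<comment> \<open>Only the index with \<open>\<sigma> \<omega> = enat k\<close> can
        contribute.\<close>
      have "(\<Sum>j. indicator (A j) \<omega> * ennreal (sup_tail (x - walk \<xi> j \<omega>))) =
          (\<Sum>j\<in>{k}. indicator (A j) \<omega> * ennreal (sup_tail (x - walk \<xi> j \<omega>)))"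
        by (rule suminf_finite) (auto simp: A_def k)
      also have "\<dots> = ennreal (?f \<omega>)"
        using elim(2) by (auto simp: A_def k indicator_def)
      finally show ?case .
    qed
  qed
  finally have "emeasure P (?U - ?V) = (\<integral>\<^sup>+\<omega>. ennreal (?f \<omega>) \<partial>P)" .
  then have "measure P (?U - ?V) = (\<integral>\<omega>. ?f \<omega> \<partial>P)"
    unfolding measure_def by (subst integral_eq_nn_integral) (auto simp: sup_tail_nonneg)
  moreover have "measure P (?U - ?V) = measure P ?U - measure P ?V"
    using U V by (intro P.finite_measure_Diff) (auto simp: less_walk_max_iff)
  ultimately show ?thesis by (simp add: measure_walk_crossing)
qed

end

end

section \<open>From distribution functions in S_gamma to measures\<close>

lemma class_S_convolution_equivalent:
  assumes "0 < \<gamma>" "F \<in> class_S \<gamma>"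
  shows "convolution_equivalent (interval_measure F) \<gamma>"
    and "tail F = upper_tail (interval_measure F)"
    and "mgf F \<gamma> = ennreal (\<integral>x. exp (\<gamma> * x) \<partial>interval_measure F)"
    and "cdf (interval_measure F) = F"
proof -
  let ?M = "interval_measure F"
  have F: "\<And>x y. x \<le> y \<Longrightarrow> F x \<le> F y" "\<And>a. continuous (at_right a) F" "(F \<longlongrightarrow> 0) at_bot" "(F \<longlongrightarrow> 1) at_top"
    and pos: "\<And>x. 0 < tail F x"
    and lim: "\<And>k. ((\<lambda>x. tail F (x - k) / tail F x) \<longlongrightarrow> exp (\<gamma> * k)) at_top"
    and fin: "mgf F \<gamma> < \<infinity>"
    and conv: "((\<lambda>x. tail (conv2 F) x / (2 * enn2real (mgf F \<gamma>) * tail F x)) \<longlongrightarrow> 1) at_top"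
    using assms(2) by (auto simp: class_S_def class_L_def distribution_function_def mono_def)
  interpret real_distribution ?M
    by (rule real_distribution_interval_measure) (fact F)+
  show cdf: "cdf ?M = F"
    by (rule cdf_interval_measure) (fact F)+
  show tail: "tail F = upper_tail ?M"
    by (auto simp: fun_eq_iff upper_tail_eq cdf tail_def)
  have int: "integrable ?M (\<lambda>x. exp (\<gamma> * x))"
    using fin by (intro integrableI_bounded) (auto simp: mgf_def)
  show mgf: "mgf F \<gamma> = ennreal (\<integral>x. exp (\<gamma> * x) \<partial>?M)"
    unfolding mgf_def by (rule nn_integral_eq_integral[OF int]) auto
  let ?\<phi> = "\<integral>x. exp (\<gamma> * x) \<partial>?M"
  have "0 \<le> ?\<phi>" by (rule integral_nonneg_AE) simp
  then have \<phi>: "enn2real (mgf F \<gamma>) = ?\<phi>" by (simp add: mgf)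
  \<comment> \<open>Division by 0 yields 0, so \<open>?\<phi> = 0\<close> would make the ratio in
    \<open>class_S\<close> constantly 0, against its limit 1. This allows the factor
    \<open>2 * ?\<phi>\<close> to be cleared.\<close>
  have "?\<phi> \<noteq> 0"
  proof
    assume "?\<phi> = 0"
    then have "((\<lambda>x::real. 0::real) \<longlongrightarrow> 1) at_top" using conv by (simp add: \<phi>)
    then show False by (simp add: tendsto_const_iff)
  qed
  have "((\<lambda>x. 2 * ?\<phi> * (tail (conv2 F) x / (2 * ?\<phi> * tail F x))) \<longlongrightarrow> 2 * ?\<phi> * 1) at_top"
    using conv unfolding \<phi> by (intro tendsto_intros)
  moreover have "2 * ?\<phi> * (tail (conv2 F) x / (2 * ?\<phi> * tail F x)) =
      (\<integral>y. upper_tail ?M (x - y) \<partial>?M) / upper_tail ?M x" for x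
    using \<open>?\<phi> \<noteq> 0\<close> upper_tail_convolution[OF real_distribution_axioms real_distribution_axioms, of x]
    by (simp add: tail_def[of "cdf (convolution ?M ?M)" x] conv2_def tail)
  ultimately show "convolution_equivalent ?M \<gamma>"
    by unfold_locales (use assms(1) pos lim int in \<open>auto simp: tail\<close>)
qed

context convolution_equivalent
begin

lemma sup_tail_shift_tendsto:
  assumes "phi < 1"
  shows "((\<lambda>x. sup_tail (x - k) / T x) \<longlongrightarrow>
    (\<integral>s. exp (\<gamma> * path_sup s) \<partial>paths) / (1 - phi) * exp (\<gamma> * k)) at_top"
proof -
  have "filterlim (\<lambda>x. x - k) at_top at_top"
    using filterlim_tendsto_add_at_top[OF tendsto_const[of "- k"] filterlim_ident] by simp
  from filterlim_compose[OF sup_tail_tendsto[OF assms] this]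
  have "((\<lambda>x. sup_tail (x - k) / T (x - k) * (T (x - k) / T x)) \<longlongrightarrow>
      (\<integral>s. exp (\<gamma> * path_sup s) \<partial>paths) / (1 - phi) * exp (\<gamma> * k)) at_top"
    by (rule tendsto_mult[OF _ upper_tail_shift])
  moreover have "sup_tail (x - k) / T (x - k) * (T (x - k) / T x) = sup_tail (x - k) / T x" for x
    using upper_tail_pos[of "x - k"] by simp
  ultimately show ?thesis by (simp only:)
qed

end

section \<open>The limit for the stopped maximum\<close>

locale convolution_equivalent_walk = convolution_equivalent M \<gamma> + iid_walk M P \<xi>
  for M \<gamma> and P :: "'a measure" and \<xi>
begin

lemma stopped_max_tail_tendsto:
  assumes phi: "phi < 1"
    and stop: "stopping_time (walk_filtration P \<xi>) \<sigma>"
    and fin: "AE \<omega> in P. \<sigma> \<omega> < \<infinity>"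
    and le_0: "AE \<omega> in P. walk \<xi> (the_enat (\<sigma> \<omega>)) \<omega> \<le> 0"
  shows "((\<lambda>x. measure P {\<omega> \<in> space P. x < walk_max \<xi> (the_enat (\<sigma> \<omega>)) \<omega>} / T x) \<longlongrightarrow>
    (1 - (\<integral>\<omega>. exp (\<gamma> * walk \<xi> (the_enat (\<sigma> \<omega>)) \<omega>) \<partial>P)) *
      ((\<integral>s. exp (\<gamma> * path_sup s) \<partial>paths) / (1 - phi))) at_top"
proof -
  define Y where "Y \<omega> = walk \<xi> (the_enat (\<sigma> \<omega>)) \<omega>" for \<omega>
  define Z where "Z \<omega> = walk_max \<xi> (the_enat (\<sigma> \<omega>)) \<omega>" for \<omega>
  have [measurable]: "Y \<in> borel_measurable P" "Z \<in> borel_measurable P"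
    unfolding Y_def Z_def using measurable_stopped_walk[OF stop] by auto
  define C where "C = (\<integral>s. exp (\<gamma> * path_sup s) \<partial>paths) / (1 - phi)"
  obtain K where K: "\<And>x. sup_tail x \<le> K * T x" "0 \<le> K"
    using sup_tail_bound[OF phi] by blast
  have "((\<lambda>x. \<integral>\<omega>. indicator {..x} (Z \<omega>) * (sup_tail (x - Y \<omega>) / T x) \<partial>P) \<longlongrightarrow>
      (\<integral>\<omega>. C * exp (\<gamma> * Y \<omega>) \<partial>P)) at_top"
  proof (rule integral_dominated_convergence_at_top[where w="\<lambda>_. K"])
    show "AE \<omega> in P. ((\<lambda>x. indicator {..x} (Z \<omega>) * (sup_tail (x - Y \<omega>) / T x)) \<longlongrightarrow> C * exp (\<gamma> * Y \<omega>)) at_top"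
    proof (rule AE_I2)
      fix \<omega>
      \<comment> \<open>For a fixed \<open>\<omega>\<close> the stopped maximum
        \<open>Z \<omega>\<close> is one real number, so the indicator is eventually 1.\<close>
      have "\<forall>\<^sub>F x in at_top. sup_tail (x - Y \<omega>) / T x = indicator {..x} (Z \<omega>) * (sup_tail (x - Y \<omega>) / T x)"
        using eventually_ge_at_top[of "Z \<omega>"] by eventually_elim simp
      then show "((\<lambda>x. indicator {..x} (Z \<omega>) * (sup_tail (x - Y \<omega>) / T x)) \<longlongrightarrow> C * exp (\<gamma> * Y \<omega>)) at_top"
        using sup_tail_shift_tendsto[OF phi, of "Y \<omega>"] unfolding C_def by (rule Lim_transform_eventually[rotated])
    qed
    \<comment> \<open>The sign of the stopped walk enters here: \<open>Y \<omega> \<le> 0\<close>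
      gives \<open>sup_tail (x - Y \<omega>) \<le> sup_tail x \<le> K * T x\<close>, so the constant
      \<open>K\<close> dominates for every \<open>x\<close>.\<close>
    have "AE \<omega> in P. norm (indicator {..x} (Z \<omega>) * (sup_tail (x - Y \<omega>) / T x)) \<le> K" for x
      using le_0
    proof eventually_elim
      case (elim \<omega>)
      then have "sup_tail (x - Y \<omega>) \<le> K * T x"
        using sup_tail_antimono[of x "x - Y \<omega>"] K(1)[of x] by (simp add: Y_def)
      then have "sup_tail (x - Y \<omega>) / T x \<le> K" "0 \<le> sup_tail (x - Y \<omega>) / T x"
        using upper_tail_pos[of x] sup_tail_nonneg by (auto simp: pos_divide_le_eq)
      then show ?case using K(2) by (simp add: indicator_def del: abs_divide)
    qed
    then show "\<forall>\<^sub>F x in at_top. AE \<omega> in P. norm (indicator {..x} (Z \<omega>) * (sup_tail (x - Y \<omega>) / T x)) \<le> K"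
      by (rule always_eventually[OF allI])
  qed (auto simp: borel_measurable_sup_tail)
  then have "((\<lambda>x. sup_tail x / T x - (\<integral>\<omega>. indicator {..x} (Z \<omega>) * sup_tail (x - Y \<omega>) \<partial>P) / T x) \<longlongrightarrow>
      C - C * (\<integral>\<omega>. exp (\<gamma> * Y \<omega>) \<partial>P)) at_top"
    using sup_tail_tendsto[OF phi] unfolding C_def by (intro tendsto_diff) auto
  moreover have "measure P {\<omega> \<in> space P. x < Z \<omega>} / T x =
      sup_tail x / T x - (\<integral>\<omega>. indicator {..x} (Z \<omega>) * sup_tail (x - Y \<omega>) \<partial>P) / T x" for x
    using measure_stopped_max[OF stop fin, of x] by (simp add: Y_def Z_def diff_divide_distrib)
  moreover have "C - C * (\<integral>\<omega>. exp (\<gamma> * Y \<omega>) \<partial>P) = (1 - (\<integral>\<omega>. exp (\<gamma> * Y \<omega>) \<partial>P)) * C"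
    by (simp add: algebra_simps)
  ultimately have "((\<lambda>x. measure P {\<omega> \<in> space P. x < Z \<omega>} / T x) \<longlongrightarrow>
      (1 - (\<integral>\<omega>. exp (\<gamma> * Y \<omega>) \<partial>P)) * C) at_top"
    by (simp only:)
  then show ?thesis
    unfolding Y_def Z_def C_def .
qed

end

theorem theorem4:
  fixes P :: "'a measure" and F :: "real \<Rightarrow> real" and \<gamma> :: real
    and \<xi> :: "nat \<Rightarrow> 'a \<Rightarrow> real" and \<sigma> :: "'a \<Rightarrow> enat" and chi :: "'a \<Rightarrow> real"
  assumes "prob_space P"
    and "\<gamma> > 0"
    and "distribution_function F"
    and "F \<in> class_S \<gamma>"
    and "mgf F \<gamma> < 1"
    and "prob_space.indep_vars P (\<lambda>_. borel) \<xi> {1..}"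
    and "\<And>n. n \<ge> 1 \<Longrightarrow> cdf (distr P borel (\<xi> n)) = F"
    and "stopping_time (walk_filtration P \<xi>) \<sigma>"
    and "\<And>\<omega>. \<omega> \<in> space P \<Longrightarrow> \<sigma> \<omega> \<ge> 1"
    and "AE \<omega> in P. \<sigma> \<omega> < \<infinity>"
    and "AE \<omega> in P. walk \<xi> (the_enat (\<sigma> \<omega>)) \<omega> \<le> 0"
    and "\<And>\<omega>. chi \<omega> = - walk \<xi> (the_enat (\<sigma> \<omega>)) \<omega>"
  shows "((\<lambda>x. measure P {\<omega> \<in> space P. walk_max \<xi> (the_enat (\<sigma> \<omega>)) \<omega> > x} / tail F x)
           \<longlongrightarrow> (1 - (\<integral>\<omega>. exp (- \<gamma> * chi \<omega>) \<partial>P)) *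
               ((\<integral>\<omega>. exp (\<gamma> * real_of_ereal (walk_sup \<xi> \<omega>)) \<partial>P) / (1 - enn2real (mgf F \<gamma>)))) at_top"
proof -
  let ?M = "interval_measure F"
  note S = class_S_convolution_equivalent[OF assms(2,4)]
  interpret P: prob_space P by fact
  interpret convolution_equivalent ?M \<gamma> by (rule S)
  have law: "distr P borel (\<xi> n) = ?M" if "1 \<le> n" for n
  proof (rule cdf_unique)
    show "real_distribution (distr P borel (\<xi> n))"
      using assms(6) that by (intro P.real_distribution_distr) (auto simp: P.indep_vars_def)
  qed (use assms(7)[OF that] S(4) real_distribution_axioms in auto)
  interpret convolution_equivalent_walk ?M \<gamma> P \<xi>
    by unfold_locales (use assms(6) law in auto)
  \<comment> \<open>Nonnegativity lets the \<open>ennreal\<close> hypothesis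
    \<open>mgf F \<gamma> < 1\<close> be read as an inequality between reals.\<close>
  have "0 \<le> phi" by (rule integral_nonneg_AE) simp
  moreover from this have "phi < 1"
    using assms(5) by (simp add: S(3) ennreal_less_iff flip: ennreal_1)
  ultimately show ?thesis
    using stopped_max_tail_tendsto[OF _ assms(8,10,11)]
    by (simp add: S(2,3) assms(12) integral_exp_walk_sup)
qed

end
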